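(* Let $K$ be a Valdivia compact space admitting a $G_\delta$ point $x$ (i.e., $\{x\}$ is a countable intersection of open sets) with $w(x,K)\ge\mathfrak c$. Then there exists a nontrivial twisted sum of $c_0$ and $C(K)$. In particular, assuming the Continuum Hypothesis, if $K$ is a Valdivia compact space admitting a $G_\delta$ point having no second countable neighborhood, then there exists a nontrivial twisted sum of $c_0$ and $C(K)$.
   Context: For a compact Hausdorff space $K$, $C(K)$ is the Banach space of continuous real-valued functions on $K$ with the supremum norm; $c_0$ is the Banach space of real sequences converging to zero. For Banach spaces $Y,X$, a twisted sum of $Y$ and $X$ is a short exact sequence $0\to Y\to Z\to X\to 0$ with $Z$ a Banach space and bounded linear maps; it is trivial if the image of $Y\to Z$ is complemented in $Z$. $\mathfrak c$ is the cardinality of the continuum. For an index set $I$, $\Sigma(I)=\{x\in\mathbb R^I:\{i: x_i\neq0\}\text{ is countable}\}$. A subset $A$ of a compact Hausdorff space $K$ is a $\Sigma$-subset if there exist an index set $I$ and a continuous injection $\varphi:K\to\mathbb R^I$ with $A=\varphi^{-1}[\Sigma(I)]$; $K$ is a Valdivia compactum if it admits a dense $\Sigma$-subset. For a point $x$ of a space $\mathcal X$, $w(x,\mathcal X)=\min\{w(V): V\text{ a neighborhood of }x\text{ in }\mathcal X\}$, where $w(V)$ is the weight (minimal cardinality of a base) of $V$. *)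

theory Defs
  imports "HOL-Analysis.Analysis"
begin

definition is_base_on :: "'a::topological_space set \<Rightarrow> 'a set set \<Rightarrow> bool" where
  "is_base_on V B \<longleftrightarrow>
     (\<forall>b\<in>B. openin (top_of_set V) b) \<and>
     (\<forall>U. openin (top_of_set V) U \<longrightarrow> (\<exists>B'\<subseteq>B. \<Union>B' = U))"

definition nbhd_in :: "'a::topological_space set \<Rightarrow> 'a \<Rightarrow> 'a set \<Rightarrow> bool" where
  "nbhd_in K x V \<longleftrightarrow> V \<subseteq> K \<and> (\<exists>U. openin (top_of_set K) U \<and> x \<in> U \<and> U \<subseteq> V)"

definition card_ge_continuum :: "'b set \<Rightarrow> bool" where
  "card_ge_continuum B \<longleftrightarrow> (\<exists>f::real \<Rightarrow> 'b. inj f \<and> range f \<subseteq> B)"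

definition local_weight_ge_continuum :: "'a::topological_space set \<Rightarrow> 'a \<Rightarrow> bool" where
  "local_weight_ge_continuum K x \<longleftrightarrow>
     (\<forall>V B. nbhd_in K x V \<and> is_base_on V B \<longrightarrow> card_ge_continuum B)"

definition G_delta_point :: "'a::topological_space set \<Rightarrow> 'a \<Rightarrow> bool" where
  "G_delta_point K x \<longleftrightarrow> x \<in> K \<and>
     (\<exists>U::nat \<Rightarrow> 'a set. (\<forall>n. openin (top_of_set K) (U n)) \<and> \<Inter>(range U) = {x})"

definition second_countable_nbhd :: "'a::topological_space set \<Rightarrow> 'a \<Rightarrow> 'a set \<Rightarrow> bool" where
  "second_countable_nbhd K x V \<longleftrightarrow> nbhd_in K x V \<and> (\<exists>B. countable B \<and> is_base_on V B)"

definition Sigma_prod :: "'i set \<Rightarrow> ('i \<Rightarrow> real) set" where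
  "Sigma_prod I = {y \<in> PiE I (\<lambda>_. UNIV). countable {i\<in>I. y i \<noteq> 0}}"

definition Sigma_subset :: "'a::topological_space set \<Rightarrow> 'i set \<Rightarrow> ('a \<Rightarrow> 'i \<Rightarrow> real) \<Rightarrow> 'a set \<Rightarrow> bool" where
  "Sigma_subset K I \<phi> A \<longleftrightarrow>
     continuous_map (top_of_set K) (product_topology (\<lambda>i. euclideanreal) I) \<phi> \<and>
     inj_on \<phi> K \<and> A = {t\<in>K. \<phi> t \<in> Sigma_prod I}"

text \<open>Valdivia witnessed by an index set \<open>I\<close> of some type \<open>'i\<close>; the type \<open>'i\<close>
  is universally quantified at the theorem level, so this is faithful.\<close>
definition Valdivia_via :: "'a::topological_space set \<Rightarrow> 'i set \<Rightarrow> ('a \<Rightarrow> 'i \<Rightarrow> real) \<Rightarrow> bool" where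
  "Valdivia_via K I \<phi> \<longleftrightarrow>
     (\<exists>A. Sigma_subset K I \<phi> A \<and> K \<subseteq> closure A)"

definition banach_on ::
  "'z set \<Rightarrow> ('z \<Rightarrow> 'z \<Rightarrow> 'z) \<Rightarrow> (real \<Rightarrow> 'z \<Rightarrow> 'z) \<Rightarrow> 'z \<Rightarrow> ('z \<Rightarrow> real) \<Rightarrow> bool" where
  "banach_on Z add scl z0 N \<longleftrightarrow>
     z0 \<in> Z \<and> (\<forall>x\<in>Z. \<forall>y\<in>Z. add x y \<in> Z) \<and> (\<forall>a. \<forall>x\<in>Z. scl a x \<in> Z) \<and>
     (\<forall>x\<in>Z. \<forall>y\<in>Z. \<forall>w\<in>Z. add (add x y) w = add x (add y w)) \<and>
     (\<forall>x\<in>Z. \<forall>y\<in>Z. add x y = add y x) \<and>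
     (\<forall>x\<in>Z. add x z0 = x) \<and>
     (\<forall>x\<in>Z. add x (scl (-1) x) = z0) \<and>
     (\<forall>a b. \<forall>x\<in>Z. scl a (scl b x) = scl (a * b) x) \<and>
     (\<forall>x\<in>Z. scl 1 x = x) \<and>
     (\<forall>a. \<forall>x\<in>Z. \<forall>y\<in>Z. scl a (add x y) = add (scl a x) (scl a y)) \<and>
     (\<forall>a b. \<forall>x\<in>Z. scl (a + b) x = add (scl a x) (scl b x)) \<and>
     (\<forall>x\<in>Z. 0 \<le> N x) \<and>
     (\<forall>x\<in>Z. N x = 0 \<longleftrightarrow> x = z0) \<and>
     (\<forall>a. \<forall>x\<in>Z. N (scl a x) = \<bar>a\<bar> * N x) \<and>
     (\<forall>x\<in>Z. \<forall>y\<in>Z. N (add x y) \<le> N x + N y) \<and>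
     (\<forall>s. (\<forall>n. s n \<in> Z) \<and>
          (\<forall>e>0. \<exists>M. \<forall>m\<ge>M. \<forall>n\<ge>M. N (add (s m) (scl (-1) (s n))) < e) \<longrightarrow>
          (\<exists>l\<in>Z. (\<lambda>n. N (add (s n) (scl (-1) l))) \<longlonglongrightarrow> 0))"

definition c0_space :: "(nat \<Rightarrow> real) set" where
  "c0_space = {s. s \<longlonglongrightarrow> 0}"

definition c0_norm :: "(nat \<Rightarrow> real) \<Rightarrow> real" where
  "c0_norm s = (SUP n. \<bar>s n\<bar>)"

definition CK_space :: "'a::topological_space set \<Rightarrow> ('a \<Rightarrow> real) set" where
  "CK_space K = {f. continuous_on K f \<and> (\<forall>t. t \<notin> K \<longrightarrow> f t = 0)}"

definition CK_norm :: "'a set \<Rightarrow> ('a \<Rightarrow> real) \<Rightarrow> real" where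
  "CK_norm K f = (SUP t\<in>K. \<bar>f t\<bar>)"

definition closed_subspace_on ::
  "'z set \<Rightarrow> ('z \<Rightarrow> 'z \<Rightarrow> 'z) \<Rightarrow> (real \<Rightarrow> 'z \<Rightarrow> 'z) \<Rightarrow> 'z \<Rightarrow> ('z \<Rightarrow> real) \<Rightarrow> 'z set \<Rightarrow> bool" where
  "closed_subspace_on Z add scl z0 N W \<longleftrightarrow>
     W \<subseteq> Z \<and> z0 \<in> W \<and> (\<forall>x\<in>W. \<forall>y\<in>W. add x y \<in> W) \<and> (\<forall>a. \<forall>x\<in>W. scl a x \<in> W) \<and>
     (\<forall>s l. (\<forall>n. s n \<in> W) \<and> l \<in> Z \<and> (\<lambda>n. N (add (s n) (scl (-1) l))) \<longlonglongrightarrow> 0 \<longrightarrow> l \<in> W)"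

definition complemented_on ::
  "'z set \<Rightarrow> ('z \<Rightarrow> 'z \<Rightarrow> 'z) \<Rightarrow> (real \<Rightarrow> 'z \<Rightarrow> 'z) \<Rightarrow> 'z \<Rightarrow> ('z \<Rightarrow> real) \<Rightarrow> 'z set \<Rightarrow> bool" where
  "complemented_on Z add scl z0 N Y \<longleftrightarrow>
     (\<exists>W. closed_subspace_on Z add scl z0 N W \<and> Y \<inter> W = {z0} \<and>
          (\<forall>z\<in>Z. \<exists>y\<in>Y. \<exists>w\<in>W. z = add y w))"

text \<open>A nontrivial twisted sum \<open>0 \<rightarrow> c\<^sub>0 \<rightarrow> Z \<rightarrow> C(K) \<rightarrow> 0\<close>.  Every twisted sum is
  (isometrically) isomorphic to one whose carrier lies in a set of cardinality
  \<open>|c\<^sub>0 \<times> C(K)|\<close>, so the carrier type \<open>(nat \<Rightarrow> real) \<times> ('a \<Rightarrow> real)\<close> loses no generality.\<close>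
definition nontrivial_twisted_sum_c0_CK :: "'a::topological_space set \<Rightarrow> bool" where
  "nontrivial_twisted_sum_c0_CK K \<longleftrightarrow>
     (\<exists>(Z :: ((nat \<Rightarrow> real) \<times> ('a \<Rightarrow> real)) set) add scl z0 N
        (j :: (nat \<Rightarrow> real) \<Rightarrow> (nat \<Rightarrow> real) \<times> ('a \<Rightarrow> real))
        (q :: (nat \<Rightarrow> real) \<times> ('a \<Rightarrow> real) \<Rightarrow> ('a \<Rightarrow> real)).
        banach_on Z add scl z0 N \<and>
        \<comment> \<open>\<open>j\<close> bounded linear \<open>c\<^sub>0 \<rightarrow> Z\<close>\<close>
        j ` c0_space \<subseteq> Z \<and>
        (\<forall>y1\<in>c0_space. \<forall>y2\<in>c0_space. j (\<lambda>n. y1 n + y2 n) = add (j y1) (j y2)) \<and>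
        (\<forall>a. \<forall>y\<in>c0_space. j (\<lambda>n. a * y n) = scl a (j y)) \<and>
        (\<exists>M. \<forall>y\<in>c0_space. N (j y) \<le> M * c0_norm y) \<and>
        \<comment> \<open>\<open>q\<close> bounded linear \<open>Z \<rightarrow> C(K)\<close>\<close>
        q ` Z \<subseteq> CK_space K \<and>
        (\<forall>z\<in>Z. \<forall>w\<in>Z. q (add z w) = (\<lambda>t. q z t + q w t)) \<and>
        (\<forall>a. \<forall>z\<in>Z. q (scl a z) = (\<lambda>t. a * q z t)) \<and>
        (\<exists>M. \<forall>z\<in>Z. CK_norm K (q z) \<le> M * N z) \<and>
        \<comment> \<open>exactness\<close>
        inj_on j c0_space \<and>
        j ` c0_space = {z\<in>Z. q z = (\<lambda>_. 0)} \<and>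
        q ` Z = CK_space K \<and>
        \<comment> \<open>nontriviality\<close>
        \<not> complemented_on Z add scl z0 N (j ` c0_space))"

definition CH :: bool where
  "CH \<longleftrightarrow> (\<forall>A::real set. \<not> countable A \<longrightarrow> (\<exists>f. bij_betw f A (UNIV::real set)))"

end

(*
  Let T : C(K) -> l_inf/c_0 be an operator without a bounded lift to l_inf; then the pullback
  Z = {(s, f). s represents T f} is a nontrivial twisted sum. We take
  T f = sum over p of (f (y p) - f (z p)) times the class of the indicator of branch p,
  where p = (n, u) with u : nat -> nat, and branch (n, u) consists of the (codes of) initial
  segments of u that are followed by the value n. These sets are almost disjoint, but for every
  function b of p with natural values and every N there are u_0, ..., u_{N-1} and a k in all
  branch (n, u_n), n < N, with k >= b (n, u_n) (a Baire category argument). If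
  (f (y p) - f (z p))_p is a null family for every f and h p are norm one functions separating
  y p from z p, with disjoint supports for different n, a bounded lift would take norms at least
  N/2 at the functions h (0, u_0) + ... + h (N-1, u_{N-1}) of norm 1.

  The points y (n, u), z (n, u) are found close to x, where close refers to a function
  g with zero set {x}. A maximal family of pairs in {g < c} from the dense Sigma-subset
  whose difference sets are pairwise disjoint has cardinality at least the continuum; otherwise
  the coordinate retraction onto a small good set of coordinates containing all difference sets
  is the identity on {g < c}, which then has a small base. Disjointness of the difference sets
  makes f (y p) - f (z p) a null family for fixed n, continuity at x does it for varying n.
*)
theory Submission
  imports Defs
begin

section \<open>Sets of cardinality at least the continuum\<close>

text \<open>The obstacle is that the functions \<open>h p\<close> of one level \<open>n\<close> may
  overlap in an uncontrolled way, so that a sum of them can have large norm; only functions of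
  different levels have disjoint supports. A lower bound for a lift therefore has to use one branch
  per level, and these branches must share a place \<open>k\<close> beyond thresholds that depend on
  the unknown lift. This is the reason for letting \<open>n\<close> be the value that follows an
  initial segment: one segment can be continued by different values and so lies on branches of all
  levels. The size of the continuum enters twice: Baire space indexes the pairs of each level, and
  bounding \<open>g\<close> away from 0 throughout a level uses that the continuum is not a
  countable union of smaller sets. A complement of c_0 gives at first only a linear section;
  closedness of the complement and Zabreiko's lemma make it bounded.\<close>

lemma card_ge_continuum_iff: "card_ge_continuum B \<longleftrightarrow> (UNIV::real set) \<lesssim> B"
  by (auto simp: card_ge_continuum_def lepoll_def)

lemma card_ge_continuum_iff': "card_ge_continuum B \<longleftrightarrow> (UNIV::nat set set) \<lesssim> B"
  unfolding card_ge_continuum_iff using nat_sets_eqpoll_reals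
  by (meson eqpoll_imp_lepoll eqpoll_sym lepoll_trans)

lemma card_ge_continuum_nat_set:
  assumes "card_ge_continuum B"
  shows "\<exists>f :: nat set \<Rightarrow> 'b. inj f \<and> range f \<subseteq> B"
  using assms by (auto simp: card_ge_continuum_iff' lepoll_def)

lemma card_ge_continuum_baire:
  assumes "card_ge_continuum B"
  shows "\<exists>f :: (nat \<Rightarrow> nat) \<Rightarrow> 'b. inj f \<and> range f \<subseteq> B"
proof -
  obtain f :: "nat set \<Rightarrow> 'b" where f: "inj f" "range f \<subseteq> B"
    using card_ge_continuum_nat_set[OF assms] by blast
  define h :: "(nat \<Rightarrow> nat) \<Rightarrow> nat set" where "h = (\<lambda>u. {prod_encode (n, u n) | n. True})"
  have "u = v" if "h u = h v" for u v
  proof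
    fix n
    have "prod_encode (n, u n) \<in> h v" using that unfolding h_def by blast
    then show "u n = v n" by (auto simp: h_def)
  qed
  then have "inj (f \<circ> h)" using f(1) by (auto simp: inj_def)
  moreover have "range (f \<circ> h) \<subseteq> B" using f(2) by auto
  ultimately show ?thesis by blast
qed

text \<open>Koenig's diagonal argument, applied to sequences of reals, which are coded as sets of
  naturals.\<close>

lemma card_ge_continuum_UN:
  assumes "card_ge_continuum (\<Union>n::nat. B n)"
  shows "\<exists>n. card_ge_continuum (B n)"
proof (rule ccontr)
  assume neg: "\<nexists>n. card_ge_continuum (B n)"
  obtain f :: "nat set \<Rightarrow> _" where f: "inj f \<and> range f \<subseteq> (\<Union>n. B n)"
    using card_ge_continuum_nat_set[OF assms] ..
  obtain e :: "real \<Rightarrow> nat set" where e: "inj e"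
    using eqpoll_imp_lepoll[OF eqpoll_sym[OF nat_sets_eqpoll_reals]] unfolding lepoll_def by blast
  define h :: "(nat \<Rightarrow> real) \<Rightarrow> nat set" where "h = (\<lambda>u. {prod_encode (n, m) | n m. m \<in> e (u n)})"
  have h: "u = v" if "h u = h v" for u v
  proof
    fix n
    have "m \<in> e (u n) \<longleftrightarrow> prod_encode (n, m) \<in> h u" for m u by (auto simp: h_def)
    then have "e (u n) = e (v n)" using that by blast
    then show "u n = v n" using e by (auto dest: injD)
  qed
  \<comment> \<open>The sequences sent into \<open>B n\<close> omit some value at position
    \<open>n\<close>, as otherwise \<open>B n\<close> would contain a copy of the reals. The
    sequence \<open>r\<close> of omitted values then has its image in no \<open>B n\<close>.\<close>
  have "\<exists>r. \<forall>u. f (h u) \<in> B n \<longrightarrow> u n \<noteq> r" for n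
  proof (rule ccontr)
    assume "\<nexists>r. \<forall>u. f (h u) \<in> B n \<longrightarrow> u n \<noteq> r"
    then have "\<forall>r. \<exists>u. f (h u) \<in> B n \<and> u n = r" by blast
    then obtain U where U: "\<And>r. f (h (U r)) \<in> B n \<and> U r n = r" by metis
    have "inj (\<lambda>r. f (h (U r)))" by (rule injI) (metis U f h injD)
    with neg U show False unfolding card_ge_continuum_def by (metis image_subsetI)
  qed
  then obtain r where r: "\<And>n u. f (h u) \<in> B n \<Longrightarrow> u n \<noteq> r n" by metis
  show False using f r[of r] by blast
qed

section \<open>Cardinal arithmetic below a fixed infinite set\<close>

lemma lepoll_UN:
  assumes "infinite B" "I \<lesssim> B" "\<And>i. i \<in> I \<Longrightarrow> A i \<lesssim> B"
  shows "(\<Union>i\<in>I. A i) \<lesssim> B"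
  using card_of_UNION_ordLeq_infinite[of B I A] assms unfolding lepoll_def card_of_ordLeq by blast

lemma lepoll_Un:
  assumes "infinite B" "A \<lesssim> B" "C \<lesssim> B"
  shows "A \<union> C \<lesssim> B"
  using lepoll_UN[of B "UNIV :: bool set" "\<lambda>b. if b then A else C"] assms
  by (auto simp: UNIV_bool Un_commute finite_lepoll_infinite)

lemma lepoll_Times:
  assumes "infinite B" "A \<lesssim> B" "C \<lesssim> B"
  shows "A \<times> C \<lesssim> B"
  using card_of_Sigma_ordLeq_infinite[of B A "\<lambda>_. C"] assms unfolding lepoll_def card_of_ordLeq by blast

lemma countable_lepoll_infinite: "infinite B \<Longrightarrow> countable A \<Longrightarrow> A \<lesssim> B"
  by (meson countable_def infinite_le_lepoll lepoll_def lepoll_trans subset_UNIV)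

lemma lepoll_lists_infinite:
  assumes "infinite B" "A \<lesssim> B"
  shows "lists A \<lesssim> B"
proof -
  have "{xs \<in> lists A. length xs = n} \<lesssim> B" for n
  proof (induction n)
    case 0
    have "{xs \<in> lists A. length xs = 0} = {[]}" by auto
    then show ?case using assms(1) by (simp add: finite_lepoll_infinite)
  next
    case (Suc n)
    have "{xs \<in> lists A. length xs = Suc n}
        = (\<lambda>(x, xs). x # xs) ` (A \<times> {xs \<in> lists A. length xs = n})"
      by (auto simp: length_Suc_conv image_iff)
    then show ?case using lepoll_trans[OF image_lepoll lepoll_Times[OF assms Suc]] by simp
  qed
  moreover have "lists A = (\<Union>n. {xs \<in> lists A. length xs = n})" by blast
  ultimately show ?thesis
    using lepoll_UN[of B UNIV "\<lambda>n. {xs \<in> lists A. length xs = n}"] assms(1)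
      countable_lepoll_infinite[OF assms(1), of "UNIV::nat set"] by simp
qed

text \<open>Closing off under the finitary operation \<open>g\<close> takes countably many rounds,
  each adding countable sets indexed by finite lists, so the cardinal bound survives. The countable
  type \<open>'q\<close> carries labels, later the rational intervals; the last conclusion keeps the
  hull inside any set that contains \<open>J0\<close> and the values of \<open>g\<close>.\<close>

lemma closed_hull_lepoll:
  fixes g :: "('i \<times> 'q::countable) list \<Rightarrow> 'i set"
  assumes "infinite B" "J0 \<lesssim> B" "\<And>L. countable (g L)"
  obtains J where "J0 \<subseteq> J" "J \<lesssim> B" "\<And>L. L \<in> lists (J \<times> UNIV) \<Longrightarrow> g L \<subseteq> J"
    "J \<subseteq> J0 \<union> (\<Union>L. g L)"
proof -
  define S where "S = rec_nat J0 (\<lambda>_ J. J \<union> (\<Union>L\<in>lists (J \<times> UNIV). g L))"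
  have S0: "S 0 = J0" and SS: "S (Suc k) = S k \<union> (\<Union>L\<in>lists (S k \<times> UNIV). g L)" for k
    by (auto simp: S_def)
  have mono: "S j \<subseteq> S k" if "j \<le> k" for j k
    using that by (induction k rule: dec_induct) (auto simp: SS)
  have small: "S k \<lesssim> B" for k
  proof (induction k)
    case (Suc k)
    have "lists (S k \<times> (UNIV::'q set)) \<lesssim> B"
      by (intro lepoll_lists_infinite lepoll_Times countable_lepoll_infinite Suc assms) simp
    from lepoll_UN[OF assms(1) this countable_lepoll_infinite[OF assms(1,3)]]
    have "(\<Union>L\<in>lists (S k \<times> UNIV). g L) \<lesssim> B" .
    then show ?case unfolding SS by (rule lepoll_Un[OF assms(1) Suc])
  qed (simp add: S0 assms)
  show ?thesis
  proof
    show "J0 \<subseteq> (\<Union>k. S k)" using S0 by blast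
    show "(\<Union>k. S k) \<lesssim> B"
      by (intro lepoll_UN countable_lepoll_infinite small assms) simp
    have "S k \<subseteq> J0 \<union> (\<Union>L. g L)" for k
      by (induction k) (auto simp: S0 SS)
    then show "(\<Union>k. S k) \<subseteq> J0 \<union> (\<Union>L. g L)" by blast
    fix L :: "('i \<times> 'q) list" assume L: "L \<in> lists ((\<Union>k. S k) \<times> UNIV)"
    have "\<exists>k. L \<in> lists (S k \<times> UNIV)" using L
    proof (induction L)
      case (Cons a L)
      then obtain j where "fst a \<in> S j" by auto
      obtain k where "L \<in> lists (S k \<times> UNIV)" using Cons by auto
      have "fst a \<in> S (max j k)" "L \<in> lists (S (max j k) \<times> UNIV)"
        using \<open>fst a \<in> S j\<close> \<open>L \<in> lists (S k \<times> UNIV)\<close> mono[of j "max j k"] mono[of k "max j k"] by auto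
      then show ?case by (metis Cons_in_lists_iff UNIV_I mem_Times_iff)
    qed simp
    then show "g L \<subseteq> (\<Union>k. S k)" using SS by blast
  qed
qed

lemma card_ge_continuum_lepoll: "card_ge_continuum A \<Longrightarrow> A \<lesssim> B \<Longrightarrow> card_ge_continuum B"
  unfolding card_ge_continuum_iff by (rule lepoll_trans)

lemma not_card_ge_continuum_finite: "finite A \<Longrightarrow> \<not> card_ge_continuum A"
  by (metis card_ge_continuum_def finite_imageD finite_subset infinite_UNIV_char_0)

text \<open>Adjoining \<open>nat\<close> turns a possibly finite set into an infinite one, as the
  cardinal estimates require; largeness is not created by this, since only countably many singletons
  are added.\<close>

lemma card_ge_continuum_Plus_nat:
  assumes "card_ge_continuum (A <+> (UNIV::nat set))" shows "card_ge_continuum A"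
proof -
  define S where "S n = (case n of 0 \<Rightarrow> Inl ` A | Suc n \<Rightarrow> {Inr n :: 'a + nat})" for n
  have "z \<in> (\<Union>n. S n)" if "z \<in> A <+> (UNIV::nat set)" for z
    using that
  proof
    fix a assume "z = Inl a" "a \<in> A"
    then have "z \<in> S 0" by (simp add: S_def)
    then show ?thesis by blast
  next
    fix n assume "z = Inr n"
    then have "z \<in> S (Suc n)" by (simp add: S_def)
    then show ?thesis by blast
  qed
  then have "A <+> (UNIV::nat set) \<subseteq> (\<Union>n. S n)" by (rule subsetI)
  then have "A <+> (UNIV::nat set) \<lesssim> (\<Union>n. S n)" by (rule subset_imp_lepoll)
  then obtain n where n: "card_ge_continuum (S n)"
    using card_ge_continuum_UN card_ge_continuum_lepoll[OF assms] by blast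
  then show ?thesis
  proof (cases n)
    case 0
    then show ?thesis using n card_ge_continuum_lepoll[OF _ image_lepoll] by (simp add: S_def)
  next
    case (Suc m)
    then show ?thesis using n not_card_ge_continuum_finite[of "S n"] by (simp add: S_def)
  qed
qed

section \<open>An almost disjoint family\<close>

text \<open>A branch is finite, possibly empty, when the sequence takes the value
  \<open>fst p\<close> only finitely often.\<close>

definition branch :: "nat \<times> (nat \<Rightarrow> nat) \<Rightarrow> nat set" where
  "branch p = {list_encode (map (snd p) [0..<m]) | m. snd p m = fst p}"

text \<open>For equal sequences a common segment determines the value that follows, so different
  \<open>n\<close> give disjoint branches; for different sequences a common segment is no longer
  than any place where they differ.\<close>

lemma finite_branch_inter:
  assumes "p \<noteq> p'" shows "finite (branch p \<inter> branch p')"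
proof -
  obtain n u n' u' where p: "p = (n, u)" "p' = (n', u')" by fastforce
  show ?thesis
  proof (cases "u = u'")
    case True
    then have "branch p \<inter> branch p' = {}"
      using assms p by (auto simp: branch_def list_encode_eq dest!: map_eq_imp_length_eq)
    then show ?thesis by simp
  next
    case False
    then obtain l where l: "u l \<noteq> u' l" by auto
    have "m \<le> l" if "map u [0..<m] = map u' [0..<m']" for m m'
    proof (rule ccontr)
      assume "\<not> m \<le> l"
      moreover have "m = m'" using that by (auto dest!: map_eq_imp_length_eq)
      ultimately show False using that l by (auto simp: map_eq_conv)
    qed
    then have "branch p \<inter> branch p' \<subseteq> (\<lambda>m. list_encode (map u [0..<m])) ` {..l}"
      using p by (auto simp: branch_def list_encode_eq)
    then show ?thesis using finite_surj by blast
  qed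
qed

definition extends :: "(nat \<Rightarrow> nat) \<Rightarrow> nat list \<Rightarrow> bool" where
  "extends u t \<longleftrightarrow> map u [0..<length t] = t"

lemma extends_append: "extends u (s @ t) \<Longrightarrow> extends u s"
  unfolding extends_def by (drule arg_cong[where f = "take (length s)"]) (simp add: take_map)

text \<open>The Baire category theorem for sequences of naturals: some \<open>D j\<close> is dense
  in a cylinder inside that of \<open>s\<close>. If not, each \<open>D j\<close> can be avoided in
  turn by a longer segment, and the sequence through all these segments lies in none of
  them.\<close>

lemma ex_extends_if_cover:
  fixes D :: "nat \<Rightarrow> (nat \<Rightarrow> nat) set"
  assumes "(\<Union>j. D j) = UNIV"
  shows "\<exists>t j. \<forall>t'. \<exists>u\<in>D j. extends u (s @ t @ t')"
proof (rule ccontr)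
  assume "\<nexists>t j. \<forall>t'. \<exists>u\<in>D j. extends u (s @ t @ t')"
  then have "\<forall>t j. \<exists>t'. \<forall>u\<in>D j. \<not> extends u (s @ t @ t')" by blast
  then obtain e where e: "\<And>t j u. u \<in> D j \<Longrightarrow> \<not> extends u (s @ t @ e t j)" by metis
  \<comment> \<open>The final 0 makes each stage strictly longer, also where \<open>e\<close>
    returns the empty list; hence \<open>u m\<close> can be read off at stage
    \<open>Suc m\<close>.\<close>
  define T where "T = rec_nat [] (\<lambda>j t. t @ e t j @ [0])"
  have T0: "T 0 = []" and TS: "T (Suc j) = T j @ e (T j) j @ [0]" for j
    by (auto simp: T_def)
  have len: "j \<le> length (T j)" for j
    by (induction j) (auto simp: TS)
  have pre: "\<exists>t. T (j + d) = T j @ t" for j d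
    by (induction d) (auto simp: TS)
  define u where "u = (\<lambda>m. (s @ T (Suc m)) ! m)"
  have "extends u (s @ T j)" for j
    unfolding extends_def
  proof (rule nth_equalityI)
    fix m assume "m < length (map u [0..<length (s @ T j)])"
    then have m: "m < length (s @ T j)" by simp
    have m': "m < length (s @ T (Suc m))" using len[of "Suc m"] by simp
    show "map u [0..<length (s @ T j)] ! m = (s @ T j) ! m"
    proof (cases "j \<le> Suc m")
      case True
      then obtain t where "T (Suc m) = T j @ t" using pre[of j "Suc m - j"] by auto
      then have "u m = ((s @ T j) @ t) ! m" by (simp add: u_def)
      then have "u m = (s @ T j) ! m" using m by (simp only: nth_append if_True)
      then show ?thesis using m by simp
    next
      case False
      then obtain t where "T j = T (Suc m) @ t" using pre[of "Suc m" "j - Suc m"] by auto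
      then have "(s @ T j) ! m = ((s @ T (Suc m)) @ t) ! m" by simp
      then have "(s @ T j) ! m = u m" using m' by (simp only: nth_append if_True u_def)
      then show ?thesis using m by simp
    qed
  qed simp
  moreover obtain j where "u \<in> D j" using assms by blast
  ultimately show False
    using e[of u j "T j"] extends_append[of u "s @ T j @ e (T j) j" "[0]"]
    by (metis TS append.assoc)
qed

text \<open>Density in a cylinder passes to every smaller cylinder, so the category lemma can treat
  the levels one after another while a single segment \<open>t\<close> and a single bound
  \<open>j\<close> serve all levels treated so far. A common segment can then be followed by
  \<open>n\<close> at level \<open>n\<close>, which puts its code on all the branches.\<close>

lemma ex_common_branch:
  fixes b :: "nat \<times> (nat \<Rightarrow> nat) \<Rightarrow> nat"
  shows "\<exists>u k. \<forall>n<N. k \<in> branch (n, u n) \<and> b (n, u n) \<le> k"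
proof -
  have "\<exists>t j. \<forall>t'. \<forall>n<N. \<exists>u. b (n, u) \<le> j \<and> extends u (t @ t')"
  proof (induction N)
    case 0
    show ?case by simp
  next
    case (Suc N)
    then obtain t j where tj: "\<And>t' n. n < N \<Longrightarrow> \<exists>u. b (n, u) \<le> j \<and> extends u (t @ t')"
      by blast
    obtain s i where si: "\<And>t'. \<exists>u. b (N, u) \<le> i \<and> extends u (t @ s @ t')"
      using ex_extends_if_cover[of "\<lambda>i. {u. b (N, u) \<le> i}" t] by auto
    have "\<exists>u. b (n, u) \<le> max i j \<and> extends u ((t @ s) @ t')" if "n < Suc N" for n t'
      using that tj[of n "s @ t'"] si[of t'] by (auto simp: less_Suc_eq le_max_iff_disj)
    then show ?case by blast
  qed
  then obtain t j where tj: "\<And>t' n. n < N \<Longrightarrow> \<exists>u. b (n, u) \<le> j \<and> extends u (t @ t')"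
    by blast
  \<comment> \<open>Padding by \<open>j\<close> zeros makes the length of \<open>r\<close>, hence
    its code, at least \<open>j\<close>.\<close>
  define r where "r = t @ replicate j 0"
  have le: "length xs \<le> list_encode xs" for xs
  proof (induction xs)
    case (Cons x xs)
    then show ?case using le_prod_encode_2[of "list_encode xs" x] by simp
  qed simp
  have "\<exists>u. b (n, u) \<le> j \<and> extends u (r @ [n])" if "n < N" for n
    using tj[OF that, of "replicate j 0 @ [n]"] by (simp add: r_def)
  then obtain u where u: "\<And>n. n < N \<Longrightarrow> b (n, u n) \<le> j \<and> extends (u n) (r @ [n])" by metis
  have "list_encode r \<in> branch (n, u n) \<and> b (n, u n) \<le> list_encode r" if "n < N" for n
  proof
    have "map (u n) [0..<length r] = r" "u n (length r) = n"
      using u[OF that] by (auto simp: extends_def)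
    then show "list_encode r \<in> branch (n, u n)" by (auto simp: branch_def intro!: exI[of _ "length r"])
    show "b (n, u n) \<le> list_encode r" using u[OF that] le[of r] by (simp add: r_def)
  qed
  then show ?thesis by blast
qed

section \<open>Coordinates and good sets in Valdivia compacta\<close>

locale coordinatized_compact =
  fixes K :: "'a::t2_space set" and I :: "'i set" and \<phi> :: "'a \<Rightarrow> 'i \<Rightarrow> real"
  assumes compact: "compact K"
    and cont: "continuous_map (top_of_set K) (product_topology (\<lambda>i. euclideanreal) I) \<phi>"
    and inj: "inj_on \<phi> K"
begin

lemma continuous_coord: "i \<in> I \<Longrightarrow> continuous_on K (\<lambda>t. \<phi> t i)"
  using cont by (simp add: continuous_map_componentwise)

lemma coord_eqI:
  assumes "s \<in> K" "t \<in> K" "\<And>i. i \<in> I \<Longrightarrow> \<phi> s i = \<phi> t i"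
  shows "s = t"
proof -
  have "\<phi> ` K \<subseteq> extensional I" using cont by (auto simp: continuous_map_componentwise)
  then have "\<phi> s = \<phi> t" using assms by (intro extensionalityI[of _ I]) auto
  then show ?thesis using inj assms by (auto dest: inj_onD)
qed

lemma openin_coord:
  assumes "i \<in> I" "open S" shows "openin (top_of_set K) {t \<in> K. \<phi> t i \<in> S}"
  using continuous_openin_preimage_gen[OF continuous_coord[OF assms(1)] assms(2)]
  by (simp add: vimage_def Int_def)

lemma openin_Ball:
  assumes "finite F" "\<And>i. i \<in> F \<Longrightarrow> openin (top_of_set K) {t \<in> K. P i t}"
  shows "openin (top_of_set K) {t \<in> K. \<forall>i\<in>F. P i t}"
  using assms
proof (induction F)
  case (insert i F)
  have "{t \<in> K. \<forall>j\<in>insert i F. P j t} = {t \<in> K. P i t} \<inter> {t \<in> K. \<forall>j\<in>F. P j t}" by blast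
  then show ?case using insert by (simp add: openin_Int)
qed simp

lemma finite_cover:
  assumes "\<And>a. a \<in> X \<Longrightarrow> openin (top_of_set K) (S a)" "K \<subseteq> (\<Union>a\<in>X. S a)"
  shows "\<exists>X'. X' \<subseteq> X \<and> finite X' \<and> K \<subseteq> (\<Union>a\<in>X'. S a)"
proof -
  have "\<exists>D\<subseteq>S ` X. finite D \<and> K \<subseteq> \<Union>D"
    using compact[unfolded compact_eq_openin_cover, rule_format, of "S ` X"] assms by blast
  then show ?thesis by (metis finite_subset_image)
qed

text \<open>Compactness turns separation from \<open>w\<close> in single coordinates into separation
  by one finite box. Here \<open>w\<close> is any family of reals: with \<open>U\<close> empty this
  says that the image of \<open>K\<close> is closed, and with \<open>w\<close> equal to
  \<open>\<phi> y\<close> that boxes give the topology of \<open>K\<close>.\<close>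

lemma coord_nbhd:
  assumes U: "openin (top_of_set K) U" and w: "\<And>t. t \<in> K - U \<Longrightarrow> \<exists>i\<in>I. \<phi> t i \<noteq> w i"
  obtains F e where "finite F" "F \<subseteq> I" "e > (0::real)" "{t \<in> K. \<forall>i\<in>F. \<bar>\<phi> t i - w i\<bar> < e} \<subseteq> U"
proof -
  define S where "S = (\<lambda>(i, e). U \<union> {t \<in> K. \<phi> t i \<in> {r. e < \<bar>r - w i\<bar>}})"
  have "open {r. e < \<bar>r - w i\<bar>}" for e i
    by (intro open_Collect_less continuous_intros)
  then have op: "openin (top_of_set K) (S p)" if "p \<in> I \<times> {0<..}" for p
    using that U openin_coord[of "fst p" "{r. snd p < \<bar>r - w (fst p)\<bar>}"]
    unfolding S_def by (auto intro!: openin_Un)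
  \<comment> \<open>With no coordinates the cover has no members, so not even \<open>U\<close> could
    be obtained from it.\<close>
  show ?thesis
  proof (cases "I = {}")
    case True
    then have "K \<subseteq> U" using w by blast
    then show ?thesis using that[of "{}" 1] by auto
  next
    case False
    have "t \<in> (\<Union>p\<in>I \<times> {0<..}. S p)" if t: "t \<in> K" for t
    proof (cases "t \<in> U")
      case True
      then have "t \<in> S (i, 1)" for i by (simp add: S_def)
      then show ?thesis using False by fastforce
    next
      case False
      then obtain i where i: "i \<in> I" "\<phi> t i \<noteq> w i" using w t by blast
      then have "t \<in> S (i, \<bar>\<phi> t i - w i\<bar> / 2)" using t by (simp add: S_def)
      moreover have "(i, \<bar>\<phi> t i - w i\<bar> / 2) \<in> I \<times> {0<..}" using i by simp
      ultimately show ?thesis by blast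
    qed
    then have "K \<subseteq> (\<Union>p\<in>I \<times> {0<..}. S p)" by (rule subsetI)
    then obtain X where X: "X \<subseteq> I \<times> {0<..}" "finite X" "K \<subseteq> (\<Union>p\<in>X. S p)"
      using finite_cover[of "I \<times> {0<..}" S, OF op] by meson
    \<comment> \<open>The 1 provides a minimum when the finite subcover is empty.\<close>
    define e where "e = Min (insert 1 (snd ` X))"
    have "e > 0" using X unfolding e_def by (subst Min_gr_iff) auto
    have "t \<in> U" if "t \<in> K" "\<forall>i\<in>fst ` X. \<bar>\<phi> t i - w i\<bar> < e" for t
    proof -
      obtain p where p: "p \<in> X" "t \<in> S p" using X(3) \<open>t \<in> K\<close> by blast
      have "e \<le> snd p" using X p by (simp add: e_def)
      then show ?thesis using p that by (force simp: S_def split: prod.splits)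
    qed
    then have "{t \<in> K. \<forall>i\<in>fst ` X. \<bar>\<phi> t i - w i\<bar> < e} \<subseteq> U" by blast
    moreover have "finite (fst ` X)" "fst ` X \<subseteq> I" using X by auto
    ultimately show ?thesis using that \<open>e > 0\<close> by blast
  qed
qed

text \<open>Finitely many boxes on which \<open>f\<close> is within \<open>e / 2\<close> of its
  value at the center cover \<open>K\<close>, and points that agree on the coordinates of these
  boxes lie in a common box. This yields both countable dependence and the null condition for pairs
  with disjoint difference sets.\<close>

lemma continuous_finite_coords:
  assumes f: "continuous_on K f" and "(e::real) > 0"
  shows "\<exists>F. finite F \<and> F \<subseteq> I \<and>
    (\<forall>y\<in>K. \<forall>z\<in>K. (\<forall>i\<in>F. \<phi> y i = \<phi> z i) \<longrightarrow> \<bar>f y - f z\<bar> < e)"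
proof -
  have op: "openin (top_of_set K) {t \<in> K. \<bar>f t - f s\<bar> < e / 2}" for s
    using continuous_openin_preimage_gen[OF f, of "{r. \<bar>r - f s\<bar> < e / 2}"]
    by (simp add: vimage_def Int_def open_Collect_less continuous_intros)
  have "\<exists>F d. finite F \<and> F \<subseteq> I \<and> d > 0 \<and>
      {t \<in> K. \<forall>i\<in>F. \<bar>\<phi> t i - \<phi> s i\<bar> < d} \<subseteq> {t \<in> K. \<bar>f t - f s\<bar> < e / 2}" if "s \<in> K" for s
  proof -
    have "\<exists>i\<in>I. \<phi> t i \<noteq> \<phi> s i" if "t \<in> K - {t \<in> K. \<bar>f t - f s\<bar> < e / 2}" for t
    proof -
      have "t \<noteq> s" using that assms(2) by auto
      then show ?thesis using coord_eqI[of t s] that \<open>s \<in> K\<close> by blast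
    qed
    then obtain F d where "finite F" "F \<subseteq> I" "d > (0::real)"
        "{t \<in> K. \<forall>i\<in>F. \<bar>\<phi> t i - \<phi> s i\<bar> < d} \<subseteq> {t \<in> K. \<bar>f t - f s\<bar> < e / 2}"
      by (rule coord_nbhd[OF op[of s], of "\<phi> s"])
    then show ?thesis by (intro exI conjI)
  qed
  then have "\<forall>s\<in>K. \<exists>F. \<exists>d. finite F \<and> F \<subseteq> I \<and> d > (0::real) \<and>
      {t \<in> K. \<forall>i\<in>F. \<bar>\<phi> t i - \<phi> s i\<bar> < d} \<subseteq> {t \<in> K. \<bar>f t - f s\<bar> < e / 2}"
    by (rule ballI)
  from bchoice[OF this] obtain F where "\<forall>s\<in>K. \<exists>d. finite (F s) \<and> F s \<subseteq> I \<and> d > (0::real) \<and>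
      {t \<in> K. \<forall>i\<in>F s. \<bar>\<phi> t i - \<phi> s i\<bar> < d} \<subseteq> {t \<in> K. \<bar>f t - f s\<bar> < e / 2}" ..
  from bchoice[OF this] obtain d where "\<forall>s\<in>K. finite (F s) \<and> F s \<subseteq> I \<and> d s > (0::real) \<and>
      {t \<in> K. \<forall>i\<in>F s. \<bar>\<phi> t i - \<phi> s i\<bar> < d s} \<subseteq> {t \<in> K. \<bar>f t - f s\<bar> < e / 2}" ..
  note Fd = this[rule_format]
  define T where "T s = {t \<in> K. \<forall>i\<in>F s. \<bar>\<phi> t i - \<phi> s i\<bar> < d s}" for s
  have "openin (top_of_set K) (T s)" if "s \<in> K" for s
    unfolding T_def
  proof (rule openin_Ball)
    fix i assume "i \<in> F s"
    moreover have "open {r. \<bar>r - \<phi> s i\<bar> < d s}"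
      by (intro open_Collect_less continuous_intros)
    ultimately show "openin (top_of_set K) {t \<in> K. \<bar>\<phi> t i - \<phi> s i\<bar> < d s}"
      using openin_coord[of i "{r. \<bar>r - \<phi> s i\<bar> < d s}"] Fd[OF that] by auto
  qed (use Fd[OF that] in simp)
  moreover have "K \<subseteq> (\<Union>s\<in>K. T s)" using Fd by (force simp: T_def)
  ultimately obtain X where X: "X \<subseteq> K" "finite X" "K \<subseteq> (\<Union>s\<in>X. T s)"
    using finite_cover[of K T] by meson
  have "\<bar>f y - f z\<bar> < e" if yz: "y \<in> K" "z \<in> K" "\<And>i. i \<in> (\<Union>s\<in>X. F s) \<Longrightarrow> \<phi> y i = \<phi> z i" for y z
  proof -
    obtain s where s: "s \<in> X" "\<forall>i\<in>F s. \<bar>\<phi> y i - \<phi> s i\<bar> < d s" using X yz(1) unfolding T_def by blast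
    then have "\<forall>i\<in>F s. \<bar>\<phi> z i - \<phi> s i\<bar> < d s" using yz(3) by fastforce
    then have "\<bar>f y - f s\<bar> < e / 2" "\<bar>f z - f s\<bar> < e / 2" using s Fd[of s] X yz by auto
    then show ?thesis by linarith
  qed
  moreover have "finite (\<Union>s\<in>X. F s)" "(\<Union>s\<in>X. F s) \<subseteq> I" using X Fd by blast+
  ultimately show ?thesis by (intro exI[of _ "\<Union>s\<in>X. F s"]) blast
qed

lemma continuous_countable_coords:
  fixes f :: "'a \<Rightarrow> real"
  assumes f: "continuous_on K f"
  shows "\<exists>C. countable C \<and> C \<subseteq> I \<and>
    (\<forall>y\<in>K. \<forall>z\<in>K. (\<forall>i\<in>C. \<phi> y i = \<phi> z i) \<longrightarrow> f y = f z)"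
proof -
  have "\<exists>F. finite F \<and> F \<subseteq> I \<and> (\<forall>y\<in>K. \<forall>z\<in>K. (\<forall>i\<in>F. \<phi> y i = \<phi> z i) \<longrightarrow> \<bar>f y - f z\<bar> < 1 / Suc n)" for n
    by (rule continuous_finite_coords[OF f]) simp
  then obtain F where F: "\<And>n. finite (F n)" "\<And>n. F n \<subseteq> I"
    "\<And>n y z. y \<in> K \<Longrightarrow> z \<in> K \<Longrightarrow> (\<forall>i\<in>F n. \<phi> y i = \<phi> z i) \<Longrightarrow> \<bar>f y - f z\<bar> < 1 / Suc n"
    by metis
  show ?thesis
  proof (intro exI[of _ "\<Union>n. F n"] conjI ballI impI)
    show "countable (\<Union>n. F n)" using F by (simp add: countable_finite)
    show "(\<Union>n. F n) \<subseteq> I" using F by blast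
    fix y z assume yz: "y \<in> K" "z \<in> K" "\<forall>i\<in>(\<Union>n. F n). \<phi> y i = \<phi> z i"
    have "\<bar>f y - f z\<bar> < 1 / Suc n" for n using F(3)[of y z n] yz by blast
    then show "f y = f z"
      using nat_approx_posE[of "\<bar>f y - f z\<bar>"] by (metis less_asym zero_less_abs_iff right_minus_eq)
  qed
qed

text \<open>Finite lists with rational bounds keep the boxes over a set \<open>J\<close> of
  coordinates no more numerous than an infinite set dominating \<open>J\<close>, and make them
  arguments for \<open>closed_hull_lepoll\<close>.\<close>

definition rbox :: "('i \<times> rat \<times> rat) list \<Rightarrow> 'a set" where
  "rbox L = {t \<in> K. \<forall>(i, a, b)\<in>set L. of_rat a < \<phi> t i \<and> \<phi> t i < of_rat b}"

lemma openin_rbox: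
  assumes "L \<in> lists (I \<times> UNIV)" shows "openin (top_of_set K) (rbox L)"
proof -
  have "openin (top_of_set K) {t \<in> K. case p of (i, a, b) \<Rightarrow> of_rat a < \<phi> t i \<and> \<phi> t i < of_rat b}"
    if "p \<in> set L" for p
  proof -
    obtain i a b where p: "p = (i, a, b)" by (cases p)
    then have "i \<in> I" using that assms by auto
    then show ?thesis using openin_coord[of i "{of_rat a<..<of_rat b}"] p by simp
  qed
  then show ?thesis unfolding rbox_def by (intro openin_Ball) auto
qed

lemma rbox_approx:
  assumes "finite F" "e > 0" "y \<in> K"
  obtains L where "L \<in> lists (F \<times> UNIV)" "y \<in> rbox L" "rbox L \<subseteq> {t \<in> K. \<forall>i\<in>F. \<bar>\<phi> t i - \<phi> y i\<bar> < e}"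
proof -
  have "\<exists>a b. \<phi> y i - e < of_rat a \<and> of_rat a < \<phi> y i \<and> \<phi> y i < of_rat b \<and> of_rat b < \<phi> y i + e" for i
    using of_rat_dense[of "\<phi> y i - e" "\<phi> y i"] of_rat_dense[of "\<phi> y i" "\<phi> y i + e"] assms by auto
  then obtain a b where ab: "\<And>i. \<phi> y i - e < of_rat (a i) \<and> of_rat (a i) < \<phi> y i \<and>
      \<phi> y i < of_rat (b i) \<and> of_rat (b i) < \<phi> y i + e"
    by metis
  obtain l where l: "set l = F" using assms finite_list by blast
  show ?thesis
  proof
    show "map (\<lambda>i. (i, a i, b i)) l \<in> lists (F \<times> UNIV)" using l by auto
    show "y \<in> rbox (map (\<lambda>i. (i, a i, b i)) l)" using ab assms by (auto simp: rbox_def)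
    have "\<bar>\<phi> t i - \<phi> y i\<bar> < e" if "of_rat (a i) < \<phi> t i" "\<phi> t i < of_rat (b i)" for t i
      using that ab[of i] by linarith
    then show "rbox (map (\<lambda>i. (i, a i, b i)) l) \<subseteq> {t \<in> K. \<forall>i\<in>F. \<bar>\<phi> t i - \<phi> y i\<bar> < e}"
      using l by (auto simp: rbox_def)
  qed
qed

end

locale valdivia = coordinatized_compact +
  fixes A
  assumes A_def: "A = {t \<in> K. \<phi> t \<in> Sigma_prod I}"
    and dense: "K \<subseteq> closure A"
begin

lemma A_subset: "A \<subseteq> K"
  by (auto simp: A_def)

lemma dense_inter:
  assumes "openin (top_of_set K) U" "U \<noteq> {}" shows "\<exists>t\<in>A. t \<in> U"
proof -
  obtain W where W: "open W" "U = K \<inter> W" using assms openin_open by blast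
  then have "W \<inter> closure A \<noteq> {}" using assms dense by blast
  then show ?thesis using W A_subset open_Int_closure_eq_empty[of W A] by blast
qed

definition supp :: "'a \<Rightarrow> 'b set" where "supp t = {i \<in> I. \<phi> t i \<noteq> 0}"

lemma countable_supp: "t \<in> A \<Longrightarrow> countable (supp t)"
  by (simp add: A_def Sigma_prod_def supp_def)

lemma A_I: "t \<in> K \<Longrightarrow> countable (supp t) \<Longrightarrow> t \<in> A"
  using cont by (auto simp: A_def Sigma_prod_def supp_def continuous_map_componentwise PiE_def)

text \<open>The hull \<open>J\<close> is closed under taking supports of witnesses in the dense set \<open>A\<close> for the
  rational boxes over \<open>J\<close>; compactness then makes the coordinate retraction onto \<open>J\<close> map \<open>K\<close> into \<open>K\<close>.\<close>

lemma retraction_hull: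
  assumes "infinite B" "J0 \<lesssim> B" "J0 \<subseteq> I"
  obtains J where "J0 \<subseteq> J" "J \<subseteq> I" "J \<lesssim> B"
    "\<And>y. y \<in> K \<Longrightarrow> \<exists>z\<in>K. (\<forall>i\<in>J. \<phi> z i = \<phi> y i) \<and> (\<forall>i\<in>I - J. \<phi> z i = 0)"
proof -
  define pick where "pick L = (SOME t. t \<in> A \<and> t \<in> rbox L)" for L
  have pick: "pick L \<in> A \<and> pick L \<in> rbox L" if "t \<in> A" "t \<in> rbox L" for t L
    unfolding pick_def by (rule someI[of _ t]) (simp add: that)
  \<comment> \<open>For an empty box \<open>pick L\<close> is arbitrary; testing membership in
    \<open>A\<close> is enough to make every \<open>g L\<close> countable.\<close>
  define g where "g L = (if pick L \<in> A then supp (pick L) else {})" for L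
  have "countable (g L)" for L by (simp add: g_def countable_supp)
  then obtain J where J: "J0 \<subseteq> J" "J \<lesssim> B" "\<And>L. L \<in> lists (J \<times> UNIV) \<Longrightarrow> g L \<subseteq> J"
      "J \<subseteq> J0 \<union> (\<Union>L. g L)"
    using closed_hull_lepoll[OF assms(1,2), of g] by blast
  have JI: "J \<subseteq> I" using J(4) assms(3) by (auto simp: g_def supp_def split: if_splits)
  show ?thesis
  proof (rule that[OF J(1) JI J(2)], rule ccontr)
    fix y assume y: "y \<in> K" and neg: "\<not> (\<exists>z\<in>K. (\<forall>i\<in>J. \<phi> z i = \<phi> y i) \<and> (\<forall>i\<in>I - J. \<phi> z i = 0))"
    \<comment> \<open>\<open>w\<close> lists the coordinates of the wanted retract of
      \<open>y\<close>. If no point of \<open>K\<close> has them, a finite box around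
      \<open>w\<close> misses \<open>K\<close>; but the witness picked for a rational box around
      \<open>y\<close> over \<open>F \<inter> J\<close> vanishes off \<open>J\<close> and so lies in
      that finite box.\<close>
    define w where "w i = (if i \<in> J then \<phi> y i else 0)" for i
    have "\<exists>i\<in>I. \<phi> t i \<noteq> w i" if "t \<in> K - {}" for t
    proof (rule ccontr)
      assume "\<not> ?thesis"
      then have "(\<forall>i\<in>J. \<phi> t i = \<phi> y i) \<and> (\<forall>i\<in>I - J. \<phi> t i = 0)"
        using JI by (auto simp: w_def)
      then show False using neg that by blast
    qed
    then obtain F e where F: "finite F" "F \<subseteq> I" "e > (0::real)"
        "{t \<in> K. \<forall>i\<in>F. \<bar>\<phi> t i - w i\<bar> < e} \<subseteq> {}"
      by (rule coord_nbhd[OF openin_empty])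
    obtain L where L: "L \<in> lists ((F \<inter> J) \<times> UNIV)" "y \<in> rbox L"
        "rbox L \<subseteq> {t \<in> K. \<forall>i\<in>F \<inter> J. \<bar>\<phi> t i - \<phi> y i\<bar> < e}"
      using rbox_approx[of "F \<inter> J" e y] F y by auto
    have "L \<in> lists (I \<times> UNIV)" using L(1) F(2) by auto
    then obtain t where "t \<in> A" "t \<in> rbox L" using dense_inter[OF openin_rbox] L(2) by blast
    then have p: "pick L \<in> A" "pick L \<in> rbox L" using pick by blast+
    have "g L \<subseteq> J" using L(1) by (intro J(3)) auto
    then have "supp (pick L) \<subseteq> J" using p by (simp add: g_def)
    then have "\<bar>\<phi> (pick L) i - w i\<bar> < e" if "i \<in> F" for i
      using that p(2) L(3) F(2,3) by (cases "i \<in> J") (auto simp: w_def supp_def)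
    then show False using F(4) p A_subset by blast
  qed
qed

definition diff_set :: "'a \<Rightarrow> 'a \<Rightarrow> 'b set" where "diff_set y z = {i \<in> I. \<phi> y i \<noteq> \<phi> z i}"

lemma disjoint_differences:
  assumes g: "continuous_on K g" and V: "V = {t \<in> K. g t < (c::real)}"
    and large: "\<And>B. is_base_on V B \<Longrightarrow> card_ge_continuum B"
  obtains P where "card_ge_continuum P" "pairwise disjnt P"
    "\<forall>D\<in>P. \<exists>y\<in>V. \<exists>z\<in>V. y \<noteq> z \<and> D = diff_set y z"
proof -
  \<comment> \<open>Points of \<open>A\<close> have countable supports, so these difference sets are
    countable and a small family of them has a small union.\<close>
  define \<D> where "\<D> = {diff_set y z | y z. y \<in> V \<inter> A \<and> z \<in> V \<inter> A \<and> y \<noteq> z}"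
  define Q where "Q = {P. P \<subseteq> \<D> \<and> pairwise disjnt P}"
  have "\<exists>M\<in>Q. \<forall>X\<in>Q. M \<subseteq> X \<longrightarrow> X = M"
  proof (rule subset_Zorn')
    fix C assume C: "subset.chain Q C"
    have "disjnt S T" if "S \<in> X" "T \<in> Y" "X \<in> C" "Y \<in> C" "S \<noteq> T" for S T X Y
    proof -
      have "X \<subseteq> Y \<or> Y \<subseteq> X" using C that unfolding subset.chain_def by blast
      moreover have "pairwise disjnt X" "pairwise disjnt Y"
        using C that unfolding subset.chain_def Q_def by blast+
      ultimately show ?thesis using that by (meson pairwiseD subsetD)
    qed
    moreover have "\<Union>C \<subseteq> \<D>" using C unfolding subset.chain_def Q_def by blast
    ultimately show "\<Union>C \<in> Q" unfolding Q_def pairwise_def by blast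
  qed
  then obtain P where PQ: "P \<in> Q" "\<forall>X\<in>Q. P \<subseteq> X \<longrightarrow> X = P" ..
  have P: "P \<subseteq> \<D>" "pairwise disjnt P" using PQ(1) by (simp_all add: Q_def)
  have max: "X = P" if "X \<subseteq> \<D>" "pairwise disjnt X" "P \<subseteq> X" for X
    using PQ(2) that by (simp add: Q_def)
  have "card_ge_continuum P"
  proof (rule ccontr)
    assume small: "\<not> card_ge_continuum P"
    \<comment> \<open>These coordinates go into \<open>J\<close> so that the retraction preserves
      \<open>g\<close>, and with it membership in \<open>V\<close>.\<close>
    obtain C where C: "countable C" "C \<subseteq> I"
      "\<forall>y\<in>K. \<forall>z\<in>K. (\<forall>i\<in>C. \<phi> y i = \<phi> z i) \<longrightarrow> g y = g z"
      using continuous_countable_coords[OF g] by (elim exE conjE)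
    define B where "B = P <+> (UNIV::nat set)"
    have inf: "infinite B" by (simp add: B_def)
    have PB: "P \<lesssim> B" unfolding B_def lepoll_def by (intro exI[of _ Inl]) auto
    have DC: "countable D" if "D \<in> \<D>" for D
    proof -
      obtain y z where "y \<in> A" "z \<in> A" "D = diff_set y z"
        using \<open>D \<in> \<D>\<close> by (auto simp: \<D>_def)
      then have "D \<subseteq> supp y \<union> supp z" by (auto simp: diff_set_def supp_def)
      moreover have "countable (supp y \<union> supp z)"
        using countable_supp[OF \<open>y \<in> A\<close>] countable_supp[OF \<open>z \<in> A\<close>] by simp
      ultimately show ?thesis by (rule countable_subset)
    qed
    have "D \<lesssim> B" if "D \<in> P" for D
      using countable_lepoll_infinite[OF inf DC] P(1) that by blast
    then have "(\<Union>D\<in>P. D) \<lesssim> B" by (rule lepoll_UN[OF inf PB])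
    then have "\<Union>P \<union> C \<lesssim> B"
      using lepoll_Un[OF inf _ countable_lepoll_infinite[OF inf C(1)]] by simp
    moreover have "\<Union>P \<union> C \<subseteq> I" using P(1) C(2) by (auto simp: \<D>_def diff_set_def)
    ultimately obtain J where J: "\<Union>P \<union> C \<subseteq> J" "J \<subseteq> I" "J \<lesssim> B"
      "\<And>y. y \<in> K \<Longrightarrow> \<exists>z\<in>K. (\<forall>i\<in>J. \<phi> z i = \<phi> y i) \<and> (\<forall>i\<in>I - J. \<phi> z i = 0)"
      using retraction_hull[OF inf] by metis
    \<comment> \<open>The retract \<open>z\<close> of \<open>y\<close> has a smaller support, hence
      lies in \<open>A\<close>, and the same value of \<open>g\<close>, hence lies in
      \<open>V\<close>. If it differed from \<open>y\<close>, the difference set would be nonempty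
      and disjoint from \<open>J\<close>, which covers all members of \<open>P\<close>,
      contradicting maximality.\<close>
    have zeroA: "\<phi> y i = 0" if y: "y \<in> A \<inter> V" and i: "i \<in> I - J" for y i
    proof -
      have yK: "y \<in> K" using y A_subset by blast
      then obtain z where z: "z \<in> K" "\<forall>i\<in>J. \<phi> z i = \<phi> y i" "\<forall>i\<in>I - J. \<phi> z i = 0" using J(4) by blast
      have "supp z \<subseteq> supp y" using z by (auto simp: supp_def)
      then have "countable (supp z)" using y countable_supp countable_subset by blast
      then have zA: "z \<in> A" using z(1) by (intro A_I)
      have "g z = g y" using z J(1) yK by (intro C(3)[rule_format]) auto
      then have zV: "z \<in> V" using y z V by simp
      have "y = z"
      proof (rule ccontr)
        assume "y \<noteq> z"
        then have D: "diff_set y z \<in> \<D>" using y zA zV unfolding \<D>_def by blast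
        have dj: "diff_set y z \<inter> J = {}" using z by (auto simp: diff_set_def)
        then have "\<forall>D\<in>P. disjnt D (diff_set y z)" using J(1) unfolding disjnt_def by blast
        then have "insert (diff_set y z) P = P"
          using D P by (intro max) (auto simp: pairwise_insert disjnt_sym)
        then have "diff_set y z \<subseteq> J" using J(1) by blast
        then have "diff_set y z = {}" using dj by blast
        then show False using coord_eqI[of y z] yK z \<open>y \<noteq> z\<close> by (auto simp: diff_set_def)
      qed
      then show ?thesis using z i by simp
    qed
    have opV: "openin (top_of_set K) V"
      using continuous_openin_preimage_gen[OF g, of "{..<c}"] by (simp add: V vimage_def Int_def)
    \<comment> \<open>Nonvanishing of a coordinate is an open condition, so density of
      \<open>A\<close> carries the conclusion over to all of \<open>V\<close>.\<close>
    have zero: "\<phi> y i = 0" if y: "y \<in> V" and i: "i \<in> I - J" for y i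
    proof (rule ccontr)
      assume "\<phi> y i \<noteq> 0"
      then have "V \<inter> {t \<in> K. \<phi> t i \<in> - {0}} \<noteq> {}" using y V by auto
      moreover have "openin (top_of_set K) (V \<inter> {t \<in> K. \<phi> t i \<in> - {0}})"
        using opV openin_coord[of i "- {0}"] i by (intro openin_Int) auto
      ultimately obtain t where "t \<in> A" "t \<in> V" "\<phi> t i \<noteq> 0" using dense_inter by blast
      then show False using zeroA i by blast
    qed
    \<comment> \<open>On \<open>V\<close> only the coordinates in \<open>J\<close> vary, so boxes
      over \<open>J\<close> already form a base.\<close>
    define Bs where "Bs = (\<lambda>L. V \<inter> rbox L) ` lists (J \<times> UNIV)"
    have VK: "V \<subseteq> K" using V by blast
    have "is_base_on V Bs"
      unfolding is_base_on_def
    proof (intro conjI ballI allI impI)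
      fix b assume "b \<in> Bs"
      then obtain L where L: "L \<in> lists (J \<times> UNIV)" "b = V \<inter> rbox L" by (auto simp: Bs_def)
      have "L \<in> lists (I \<times> UNIV)" using L(1) J(2) by auto
      then have "openin (top_of_set K) b" using L(2) opV openin_rbox openin_Int by blast
      then show "openin (top_of_set V) b"
        using L(2) VK by (meson inf.cobounded1 openin_subset_trans)
    next
      fix U assume U: "openin (top_of_set V) U"
      have UV: "U \<subseteq> V" using openin_subset[OF U] by simp
      have UK: "openin (top_of_set K) U" using U opV openin_trans by blast
      have "\<exists>b\<in>Bs. y \<in> b \<and> b \<subseteq> U" if y: "y \<in> U" for y
      proof -
        have yK: "y \<in> K" "y \<in> V" using y UV VK by auto
        have "\<exists>i\<in>I. \<phi> t i \<noteq> \<phi> y i" if "t \<in> K - U" for t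
          using coord_eqI[of t y] that y yK by auto
        then obtain F e where F: "finite F" "F \<subseteq> I" "e > (0::real)"
            "{t \<in> K. \<forall>i\<in>F. \<bar>\<phi> t i - \<phi> y i\<bar> < e} \<subseteq> U"
          by (rule coord_nbhd[OF UK])
        obtain L where L: "L \<in> lists ((F \<inter> J) \<times> UNIV)" "y \<in> rbox L"
            "rbox L \<subseteq> {t \<in> K. \<forall>i\<in>F \<inter> J. \<bar>\<phi> t i - \<phi> y i\<bar> < e}"
          using rbox_approx[of "F \<inter> J" e y] F yK by auto
        have "L \<in> lists (J \<times> UNIV)" using L(1) by auto
        then have "V \<inter> rbox L \<in> Bs" by (simp add: Bs_def)
        moreover have "V \<inter> rbox L \<subseteq> U"
        proof
          fix t assume t: "t \<in> V \<inter> rbox L"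
          have "\<bar>\<phi> t i - \<phi> y i\<bar> < e" if "i \<in> F" for i
            using that t L(3) zero[of t i] zero[of y i] yK F(2,3) by (cases "i \<in> J") auto
          then show "t \<in> U" using F(4) t VK by blast
        qed
        ultimately show ?thesis using L(2) yK by blast
      qed
      then have "\<Union>{b \<in> Bs. b \<subseteq> U} = U" by blast
      then show "\<exists>B'\<subseteq>Bs. \<Union>B' = U" by (intro exI[of _ "{b \<in> Bs. b \<subseteq> U}"]) auto
    qed
    then have "card_ge_continuum Bs" by (rule large)
    moreover have "lists (J \<times> (UNIV :: (rat \<times> rat) set)) \<lesssim> B"
      by (intro lepoll_lists_infinite[OF inf] lepoll_Times[OF inf] J(3)
          countable_lepoll_infinite[OF inf]) simp
    then have "Bs \<lesssim> B" unfolding Bs_def by (rule lepoll_trans[OF image_lepoll])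
    ultimately have "card_ge_continuum B" by (rule card_ge_continuum_lepoll)
    then show False using small card_ge_continuum_Plus_nat unfolding B_def by blast
  qed
  moreover have "\<forall>D\<in>P. \<exists>y\<in>V. \<exists>z\<in>V. y \<noteq> z \<and> D = diff_set y z"
    using P(1) unfolding \<D>_def by blast
  ultimately show ?thesis by (rule that[OF _ P(2)])
qed

end

section \<open>Null systems of pairs of points\<close>

lemma compact_Urysohn:
  fixes K :: "'a::t2_space set"
  assumes "compact K" "closedin (top_of_set K) S" "closedin (top_of_set K) T" "S \<inter> T = {}"
  shows "\<exists>f :: 'a \<Rightarrow> real. continuous_on K f \<and> (\<forall>t\<in>K. 0 \<le> f t \<and> f t \<le> 1) \<and>
    (\<forall>t\<in>S. f t = 0) \<and> (\<forall>t\<in>T. f t = 1)"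
proof -
  have "Hausdorff_space (euclidean :: 'a topology)"
    by (auto simp: Hausdorff_space_def disjnt_def dest!: hausdorff)
  then have "normal_space (top_of_set K)"
    using assms(1) by (intro compact_Hausdorff_or_regular_imp_normal_space)
      (auto simp: compact_space_subtopology Hausdorff_space_subtopology)
  then obtain f :: "'a \<Rightarrow> real" where "continuous_map (top_of_set K) (top_of_set {0..1}) f"
      "f ` S \<subseteq> {0}" "f ` T \<subseteq> {1}"
    using Urysohn_lemma[of "top_of_set K" S T 0 1] assms by (auto simp: disjnt_def)
  then show ?thesis by (intro exI[of _ f]) (auto simp: image_subset_iff Pi_iff)
qed

lemma G_delta_point_zero_set:
  fixes K :: "'a::t2_space set"
  assumes "compact K" "G_delta_point K x"
  obtains g :: "'a \<Rightarrow> real" where "continuous_on K g" "\<forall>t\<in>K. 0 \<le> g t"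
    "\<forall>t\<in>K. g t = 0 \<longleftrightarrow> t = x"
proof -
  obtain U :: "nat \<Rightarrow> 'a set" where xK: "x \<in> K" and U: "\<And>n. openin (top_of_set K) (U n)" "\<Inter>(range U) = {x}"
    using assms(2) unfolding G_delta_point_def by blast
  have "\<exists>f :: 'a \<Rightarrow> real. continuous_on K f \<and> (\<forall>t\<in>K. 0 \<le> f t \<and> f t \<le> 1) \<and> f x = 0 \<and>
      (\<forall>t\<in>K - U n. f t = 1)" for n
  proof -
    have "closedin (top_of_set K) {x}" using xK by (simp add: closed_subset)
    moreover have "closedin (top_of_set K) (K - U n)" using U(1)[of n] openin_subset[OF U(1)[of n]]
      by (simp add: closedin_def double_diff)
    moreover have "{x} \<inter> (K - U n) = {}" using U(2) by blast
    ultimately show ?thesis using compact_Urysohn[OF assms(1), of "{x}" "K - U n"] by simp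
  qed
  then have "\<forall>n. \<exists>f :: 'a \<Rightarrow> real. continuous_on K f \<and> (\<forall>t\<in>K. 0 \<le> f t \<and> f t \<le> 1) \<and> f x = 0 \<and>
      (\<forall>t\<in>K - U n. f t = 1)" ..
  from choice[OF this] obtain f :: "nat \<Rightarrow> 'a \<Rightarrow> real" where
    "\<forall>n. continuous_on K (f n) \<and> (\<forall>t\<in>K. 0 \<le> f n t \<and> f n t \<le> 1) \<and> f n x = 0 \<and> (\<forall>t\<in>K - U n. f n t = 1)" ..
  then have f: "continuous_on K (f n)" "t \<in> K \<Longrightarrow> 0 \<le> f n t" "t \<in> K \<Longrightarrow> f n t \<le> 1" "f n x = 0"
    "t \<in> K - U n \<Longrightarrow> f n t = 1" for n t by simp_all
  define h where "h n t = (1 / 2) ^ n * f n t" for n t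
  have h: "0 \<le> h n t" "h n t \<le> (1 / 2) ^ n" if "t \<in> K" for n t
    using f(2,3)[OF that, of n] by (auto simp: h_def mult_le_cancel_left1)
  have geo: "summable (\<lambda>n. (1 / 2 :: real) ^ n)" by (simp add: summable_geometric)
  have summ: "summable (\<lambda>n. h n t)" if "t \<in> K" for t
    by (rule summable_comparison_test'[OF geo, of 0]) (use h[OF that] in auto)
  have ul: "uniform_limit K (\<lambda>n t. \<Sum>i<n. h i t) (\<lambda>t. \<Sum>i. h i t) sequentially"
    by (rule Weierstrass_m_test[OF _ geo]) (use h in auto)
  show ?thesis
  proof (rule that; (intro ballI)?)
    show "continuous_on K (\<lambda>t. \<Sum>i. h i t)"
      by (rule uniform_limit_theorem[OF _ ul])
        (auto simp: h_def intro!: always_eventually continuous_intros f)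
    fix t assume t: "t \<in> K"
    show "0 \<le> (\<Sum>i. h i t)" using summ h t by (simp add: suminf_nonneg)
    have "(\<Sum>i. h i t) = 0 \<longleftrightarrow> (\<forall>i. h i t = 0)" using suminf_eq_zero_iff[OF summ] h t by simp
    also have "\<dots> \<longleftrightarrow> t = x"
    proof
      assume h0: "\<forall>i. h i t = 0"
      have "t \<in> U i" for i
      proof (rule ccontr)
        assume "t \<notin> U i"
        then have "f i t = 1" using f(5) t by blast
        then show False using h0[rule_format, of i] by (simp add: h_def)
      qed
      then show "t = x" using U(2) by blast
    qed (simp add: h_def f)
    finally show "(\<Sum>i. h i t) = 0 \<longleftrightarrow> t = x" .
  qed
qed

text \<open>What the twisted sum requires of \<open>K\<close>: the differences define an operator
  into c_0 over the index set, and \<open>h p\<close> is a function whose coordinate at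
  \<open>p\<close> is 1. Disjointness is required across levels only, so at most one function per
  level can safely be added up.\<close>

locale null_system =
  fixes K :: "'a::t2_space set" and y z :: "nat \<times> (nat \<Rightarrow> nat) \<Rightarrow> 'a"
    and h :: "nat \<times> (nat \<Rightarrow> nat) \<Rightarrow> 'a \<Rightarrow> real"
  assumes compact: "compact K" and yK: "y p \<in> K" and zK: "z p \<in> K"
    and null: "f \<in> CK_space K \<Longrightarrow> e > 0 \<Longrightarrow> finite {p. e \<le> \<bar>f (y p) - f (z p)\<bar>}"
    and h_CK: "h p \<in> CK_space K" and h_bounds: "0 \<le> h p t" "h p t \<le> 1"
    and h_y: "h p (y p) = 1" and h_z: "h p (z p) = 0"
    and h_disjoint: "n \<noteq> m \<Longrightarrow> h (n, u) t = 0 \<or> h (m, v) t = 0"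

context valdivia
begin

lemma diff_set_commute: "diff_set y z = diff_set z y"
  by (auto simp: diff_set_def)

text \<open>Of two distinct points one differs from \<open>x\<close>, and as the difference set does
  not depend on the order, that point can be named first. Sorting the pairs by a positive lower
  bound for \<open>g\<close> there gives countably many classes, one of which still has at least
  continuum many members. The second point may be arbitrarily close to \<open>x\<close>.\<close>

lemma annulus_pairs:
  assumes g: "continuous_on K g" "\<And>t. t \<in> K \<Longrightarrow> 0 \<le> g t" "\<And>t. t \<in> K \<Longrightarrow> g t = 0 \<longleftrightarrow> t = x"
    and large: "\<And>B. is_base_on {t \<in> K. g t < c} B \<Longrightarrow> card_ge_continuum B" and c: "c > (0::real)"
  shows "\<exists>a Y Z. 0 < a \<and> a < c \<and> (\<forall>u::nat \<Rightarrow> nat. Y u \<in> K \<and> Z u \<in> K \<and> a < g (Y u) \<and> g (Y u) < c \<and>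
      g (Z u) < c \<and> Y u \<noteq> Z u) \<and> (\<forall>u v. u \<noteq> v \<longrightarrow> disjnt (diff_set (Y u) (Z u)) (diff_set (Y v) (Z v)))"
proof -
  define V where "V = {t \<in> K. g t < c}"
  obtain P where P: "card_ge_continuum P" "pairwise disjnt P"
    "\<forall>D\<in>P. \<exists>y\<in>V. \<exists>z\<in>V. y \<noteq> z \<and> D = diff_set y z"
    by (rule disjoint_differences[OF g(1) V_def large[folded V_def]])
  \<comment> \<open>The shift by 2 makes every lower bound strictly smaller than
    \<open>c\<close>.\<close>
  define B where "B k = {D \<in> P. \<exists>y\<in>V. \<exists>z\<in>V. y \<noteq> z \<and> D = diff_set y z \<and> c / (real k + 2) < g y}" for k :: nat
  have ex: "\<exists>k::nat. c / (real k + 2) < r" if "r > 0" for r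
  proof -
    obtain k :: nat where "c / r < real k" using reals_Archimedean2 by blast
    then have "c / r < real k + 2" by simp
    then have "c / (real k + 2) < r" using that by (simp add: divide_less_eq mult.commute)
    then show ?thesis ..
  qed
  have *: "D \<in> (\<Union>k. B k)" if "D \<in> P" "y \<in> V" "z \<in> V" "y \<noteq> z" "D = diff_set y z" "y \<noteq> x" for D y z
  proof -
    have "0 < g y" using g(2,3)[of y] that by (simp add: V_def order_less_le)
    then obtain k :: nat where "c / (real k + 2) < g y" using ex by blast
    then have "D \<in> B k" unfolding B_def using that(1-5) by (intro CollectI conjI bexI[of _ y] bexI[of _ z])
    then show ?thesis by blast
  qed
  have "D \<in> (\<Union>k. B k)" if D: "D \<in> P" for D
  proof -
    obtain y z where yz: "y \<in> V" "z \<in> V" "y \<noteq> z" "D = diff_set y z" using P(3) D by blast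
    show ?thesis
      using *[OF D yz(1,2,3,4)] *[OF D yz(2,1) yz(3)[symmetric]] yz(3,4) diff_set_commute[of y z]
      by (cases "y = x") auto
  qed
  then have "P \<subseteq> (\<Union>k. B k)" by blast
  then have "card_ge_continuum (\<Union>k. B k)" using card_ge_continuum_lepoll[OF P(1) subset_imp_lepoll] by blast
  from card_ge_continuum_UN[OF this] obtain k where "card_ge_continuum (B k)" ..
  from card_ge_continuum_baire[OF this]
  obtain d :: "(nat \<Rightarrow> nat) \<Rightarrow> 'b set" where d: "inj d \<and> range d \<subseteq> B k" ..
  then have "\<forall>u. \<exists>y. \<exists>z. y \<in> V \<and> z \<in> V \<and> y \<noteq> z \<and> d u = diff_set y z \<and> c / (real k + 2) < g y"
    unfolding B_def by blast
  from choice[OF this] obtain Y where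
    "\<forall>u. \<exists>z. Y u \<in> V \<and> z \<in> V \<and> Y u \<noteq> z \<and> d u = diff_set (Y u) z \<and> c / (real k + 2) < g (Y u)" ..
  from choice[OF this] obtain Z where
    YZ: "\<forall>u. Y u \<in> V \<and> Z u \<in> V \<and> Y u \<noteq> Z u \<and> d u = diff_set (Y u) (Z u) \<and> c / (real k + 2) < g (Y u)" ..
  have "disjnt (d u) (d v)" if "u \<noteq> v" for u v
  proof -
    have "d u \<noteq> d v" "d u \<in> P" "d v \<in> P" using d that by (auto simp: B_def dest: injD)
    then show ?thesis using pairwiseD[OF P(2)] by blast
  qed
  moreover have "0 < c / (real k + 2)" "c / (real k + 2) < c"
    using c by (auto simp: divide_less_eq_1_pos field_simps intro: add_pos_nonneg)
  ultimately show ?thesis using YZ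
    by (intro exI[of _ "c / (real k + 2)"] exI[of _ Y] exI[of _ Z]) (auto simp: V_def)
qed

lemma ex_null_system:
  assumes G: "G_delta_point K x" and W: "local_weight_ge_continuum K x"
  shows "\<exists>y z h. null_system K y z h"
proof -
  have xK: "x \<in> K" using G by (simp add: G_delta_point_def)
  obtain g :: "'a \<Rightarrow> real" where g': "continuous_on K g" "\<forall>t\<in>K. 0 \<le> g t"
      "\<forall>t\<in>K. g t = 0 \<longleftrightarrow> t = x"
    by (rule G_delta_point_zero_set[OF compact G])
  note g = g'(1) g'(2,3)[rule_format]
  have open_g: "openin (top_of_set K) {t \<in> K. g t \<in> S}" if "open S" for S
    using continuous_openin_preimage_gen[OF g(1) that] by (simp add: vimage_def Int_def)
  have large: "card_ge_continuum B" if "is_base_on {t \<in> K. g t < c} B" "c > 0" for B c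
  proof -
    have "nbhd_in K x {t \<in> K. g t < c}"
      using open_g[of "{..<c}"] g(3)[of x] xK that(2) unfolding nbhd_in_def by auto
    then show ?thesis using W that unfolding local_weight_ge_continuum_def by blast
  qed
  define R where "R c = (\<lambda>(a, Y, Z). 0 < a \<and> a < c \<and> (\<forall>u::nat \<Rightarrow> nat. Y u \<in> K \<and> Z u \<in> K \<and> a < g (Y u) \<and> g (Y u) < c \<and>
      g (Z u) < c \<and> Y u \<noteq> Z u) \<and> (\<forall>u v. u \<noteq> v \<longrightarrow> disjnt (diff_set (Y u) (Z u)) (diff_set (Y v) (Z v))))" for c
  have "\<exists>q. c > 0 \<longrightarrow> R c q" for c
  proof (cases "c > 0")
    case True
    have lc: "card_ge_continuum B" if "is_base_on {t \<in> K. g t < c} B" for B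
      using large[OF that True] .
    from annulus_pairs[OF g lc True] obtain a Y Z where "R c (a, Y, Z)"
      unfolding R_def by auto
    then show ?thesis by blast
  qed simp
  then have "\<forall>c. \<exists>q. c > 0 \<longrightarrow> R c q" ..
  from choice[OF this] obtain q where q: "\<forall>c. c > 0 \<longrightarrow> R c (q c)" ..
  \<comment> \<open>Starting the next level at half the previous lower bound makes the annuli
    \<open>a n < g < C n\<close> disjoint and gives \<open>C n\<close> a geometric bound, so the
    levels shrink to \<open>x\<close>.\<close>
  define C where "C = rec_nat (1::real) (\<lambda>_ c. fst (q c) / 2)"
  have C0: "C 0 = 1" and CS: "C (Suc n) = fst (q (C n)) / 2" for n by (simp_all add: C_def)
  have pos: "C n > 0" for n
  proof (induction n)
    case (Suc n)
    then have "R (C n) (q (C n))" using q by blast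
    then have "0 < fst (q (C n))" unfolding R_def case_prod_beta by blast
    then show ?case by (simp add: CS)
  qed (simp add: C0)
  define Y where "Y p = fst (snd (q (C (fst p)))) (snd p)" for p
  define Z where "Z p = snd (snd (q (C (fst p)))) (snd p)" for p
  define a where "a n = fst (q (C n))" for n
  have "R (C n) (q (C n))" for n using q pos by blast
  then have Ra: "0 < a n" "a n < C n" and RYZ: "Y (n, u) \<in> K" "Z (n, u) \<in> K" "a n < g (Y (n, u))"
      "g (Y (n, u)) < C n" "g (Z (n, u)) < C n" "Y (n, u) \<noteq> Z (n, u)"
    and Rd: "u \<noteq> v \<Longrightarrow> disjnt (diff_set (Y (n, u)) (Z (n, u))) (diff_set (Y (n, v)) (Z (n, v)))" for n u v
    unfolding R_def a_def Y_def Z_def by (simp_all add: case_prod_beta)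
  have CS': "C (Suc n) = a n / 2" for n by (simp add: CS a_def)
  have dec: "C m \<le> a n" if "n < m" for n m
    using that
  proof (induction m rule: less_induct)
    case (less m)
    then obtain k where k: "m = Suc k" by (cases m) auto
    show ?case
    proof (cases "n = k")
      case True
      then show ?thesis using Ra(1)[of n] k by (simp add: CS')
    next
      case False
      then have "C k \<le> a n" using less k by simp
      then show ?thesis using Ra[of k] k by (simp add: CS')
    qed
  qed
  have Cle: "C n \<le> (1 / 2) ^ n" for n
  proof (induction n)
    case (Suc n)
    then show ?case using Ra(2)[of n] by (simp add: CS')
  qed (simp add: C0)
  have "\<exists>h. continuous_on K h \<and> (\<forall>t\<in>K. 0 \<le> h t \<and> h t \<le> 1) \<and> h (Y p) = 1 \<and> h (Z p) = 0 \<and>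
      (\<forall>t\<in>K. g t \<le> a (fst p) \<or> C (fst p) \<le> g t \<longrightarrow> h t = (0::real))" for p
  proof -
    obtain n u where p: "p = (n, u)" by fastforce
    \<comment> \<open>\<open>h p\<close> has to vanish at \<open>Z p\<close> and off the annulus of
      level \<open>n\<close>; \<open>Y p\<close> lies in that annulus and differs from
      \<open>Z p\<close>.\<close>
    let ?S = "insert (Z p) {t \<in> K. g t \<in> {..a n} \<union> {C n..}}"
    have "closedin (top_of_set K) {t \<in> K. g t \<in> {..a n} \<union> {C n..}}"
      using continuous_closedin_preimage[OF g(1) closed_Un[OF closed_atMost closed_atLeast], of "a n" "C n"]
      by (simp add: vimage_def Int_def)
    moreover have *: "closedin (top_of_set K) {Z p}" "closedin (top_of_set K) {Y p}"
      using RYZ[of n u] p by (auto simp: closed_subset)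
    ultimately have "closedin (top_of_set K) ?S"
      using closedin_Un by (metis insert_is_Un)
    moreover have "?S \<inter> {Y p} = {}" using RYZ[of n u] p by auto
    ultimately obtain h :: "'a \<Rightarrow> real" where "continuous_on K h" "\<forall>t\<in>K. 0 \<le> h t \<and> h t \<le> 1"
        "\<forall>t\<in>?S. h t = 0" "\<forall>t\<in>{Y p}. h t = 1"
      using compact_Urysohn[OF compact _ *(2), of ?S] by blast
    then show ?thesis using p by (intro exI[of _ h]) auto
  qed
  then have "\<forall>p. \<exists>h. continuous_on K h \<and> (\<forall>t\<in>K. 0 \<le> h t \<and> h t \<le> 1) \<and> h (Y p) = 1 \<and> h (Z p) = 0 \<and>
      (\<forall>t\<in>K. g t \<le> a (fst p) \<or> C (fst p) \<le> g t \<longrightarrow> h t = (0::real))" ..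
  from choice[OF this] obtain h where h: "\<forall>p. continuous_on K (h p) \<and> (\<forall>t\<in>K. 0 \<le> h p t \<and> h p t \<le> 1) \<and>
      h p (Y p) = 1 \<and> h p (Z p) = 0 \<and>
      (\<forall>t\<in>K. g t \<le> a (fst p) \<or> C (fst p) \<le> g t \<longrightarrow> h p t = (0::real))" ..
  define h' where "h' p t = (if t \<in> K then h p t else 0)" for p t
  have "null_system K Y Z h'"
  proof
    show "compact K" by (rule compact)
    show YK: "Y p \<in> K" and ZK: "Z p \<in> K" for p using RYZ[of "fst p" "snd p"] by simp_all
    have "continuous_on K (h' p)" for p
      using spec[OF h, of p] continuous_on_cong[of K K "h' p" "h p"] by (simp add: h'_def)
    then show "h' p \<in> CK_space K" for p by (simp add: CK_space_def h'_def)
    show "0 \<le> h' p t" "h' p t \<le> 1" for p t using spec[OF h, of p] by (simp_all add: h'_def)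
    show "h' p (Y p) = 1" "h' p (Z p) = 0" for p using spec[OF h, of p] YK ZK by (simp_all add: h'_def)
    have dj: "h' (n, u) t = 0 \<or> h' (m, v) t = 0" if nm: "n < m" for n m u v t
    proof (cases "t \<in> K \<and> a n < g t")
      case True
      then have "C m \<le> g t" using dec[OF nm] by simp
      then show ?thesis using spec[OF h, of "(m, v)"] True by (simp add: h'_def)
    next
      case False
      then show ?thesis using spec[OF h, of "(n, u)"] by (auto simp: h'_def)
    qed
    then show "h' (n, u) t = 0 \<or> h' (m, v) t = 0" if "n \<noteq> m" for n m u v t
      using that by (metis linorder_neqE_nat)
    fix f :: "'a \<Rightarrow> real" and e :: real assume "f \<in> CK_space K" and e: "e > 0"
    then have f: "continuous_on K f" by (simp add: CK_space_def)
    \<comment> \<open>Smallness of \<open>g\<close> is turned into closeness to \<open>x\<close>: on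
      the compact set where \<open>f\<close> is at least \<open>e / 2\<close> away from
      \<open>f x\<close>, the minimum of \<open>g\<close> is positive.\<close>
    obtain c where c: "c > 0" "\<forall>t\<in>K. g t < c \<longrightarrow> \<bar>f t - f x\<bar> < e / 2"
    proof -
      let ?T = "{t \<in> K. \<bar>f t - f x\<bar> \<in> {e / 2..}}"
      have "continuous_on K (\<lambda>t. \<bar>f t - f x\<bar>)" by (intro continuous_intros f)
      from continuous_closedin_preimage[OF this closed_atLeast, of "e / 2"]
      have "closedin (top_of_set K) ?T" by (simp add: vimage_def Int_def)
      then have T: "compact ?T" using compact closedin_compact by blast
      show thesis
      proof (cases "?T = {}")
        case True
        then have "\<forall>t\<in>K. \<bar>f t - f x\<bar> < e / 2" by force
        then show ?thesis using that[of 1] by simp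
      next
        case False
        then obtain s where s: "s \<in> ?T" "\<forall>t\<in>?T. g s \<le> g t"
          using continuous_attains_inf[OF T False continuous_on_subset[OF g(1)]] by blast
        then have "g s > 0" using g(2,3)[of s] e by (auto simp: order_less_le)
        moreover have "\<forall>t\<in>K. g t < g s \<longrightarrow> \<bar>f t - f x\<bar> < e / 2" using s(2) by force
        ultimately show ?thesis by (rule that)
      qed
    qed
    obtain N where N: "(1 / 2) ^ N < c" using real_arch_pow_inv[of c "1 / 2"] c by auto
    obtain F where F: "finite F" "F \<subseteq> I"
      "\<forall>y\<in>K. \<forall>z\<in>K. (\<forall>i\<in>F. \<phi> y i = \<phi> z i) \<longrightarrow> \<bar>f y - f z\<bar> < e"
      using continuous_finite_coords[OF f e] by (elim exE conjE)
    define E where "E n = {u. e \<le> \<bar>f (Y (n, u)) - f (Z (n, u))\<bar>}" for n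
    have "finite (E n)" for n
    proof -
      \<comment> \<open>Each bad pair differs at one of the finitely many coordinates in
        \<open>F\<close>, and disjoint difference sets assign different coordinates to different
        pairs.\<close>
      have "\<exists>i. i \<in> F \<inter> diff_set (Y (n, u)) (Z (n, u))" if "u \<in> E n" for u
      proof (rule ccontr)
        assume "\<nexists>i. i \<in> F \<inter> diff_set (Y (n, u)) (Z (n, u))"
        then have "\<forall>i\<in>F. \<phi> (Y (n, u)) i = \<phi> (Z (n, u)) i" using F(2) by (auto simp: diff_set_def)
        then have "\<bar>f (Y (n, u)) - f (Z (n, u))\<bar> < e" using F(3) YK ZK by blast
        then show False using that by (simp add: E_def)
      qed
      then have "\<forall>u\<in>E n. \<exists>i. i \<in> F \<inter> diff_set (Y (n, u)) (Z (n, u))" ..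
      from bchoice[OF this] obtain r where r: "\<forall>u\<in>E n. r u \<in> F \<inter> diff_set (Y (n, u)) (Z (n, u))" ..
      have "inj_on r (E n)"
      proof (rule inj_onI, rule ccontr)
        fix u v assume "u \<in> E n" "v \<in> E n" "r u = r v" "u \<noteq> v"
        moreover have "r u \<in> diff_set (Y (n, u)) (Z (n, u))" "r v \<in> diff_set (Y (n, v)) (Z (n, v))"
          using r \<open>u \<in> E n\<close> \<open>v \<in> E n\<close> by blast+
        ultimately show False using Rd[of u v n] by (auto simp: disjnt_def)
      qed
      moreover have "r ` E n \<subseteq> F" using r by blast
      ultimately show ?thesis using F(1) by (rule inj_on_finite)
    qed
    then have "finite (\<Union>n<N. Pair n ` E n)" by simp
    moreover have "{p. e \<le> \<bar>f (Y p) - f (Z p)\<bar>} \<subseteq> (\<Union>n<N. Pair n ` E n)"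
    proof
      fix p assume p: "p \<in> {p. e \<le> \<bar>f (Y p) - f (Z p)\<bar>}"
      obtain n u where nu: "p = (n, u)" by fastforce
      have "n < N"
      proof (rule ccontr)
        assume "\<not> n < N"
        then have "(1 / 2 :: real) ^ n \<le> (1 / 2) ^ N" by (intro power_decreasing) auto
        then have "C n < c" using Cle[of n] N by linarith
        then have "g (Y p) < c" "g (Z p) < c" using RYZ(4,5)[of n u] nu by auto
        then have "\<bar>f (Y p) - f x\<bar> < e / 2" "\<bar>f (Z p) - f x\<bar> < e / 2" using c(2) YK ZK by blast+
        moreover have "e \<le> \<bar>f (Y p) - f (Z p)\<bar>" using p by simp
        ultimately show False by linarith
      qed
      then show "p \<in> (\<Union>n<N. Pair n ` E n)" using p nu by (auto simp: E_def)
    qed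
    ultimately show "finite {p. e \<le> \<bar>f (Y p) - f (Z p)\<bar>}" by (rule rev_finite_subset)
  qed
  then show ?thesis by blast
qed

end

section \<open>Supremum norms\<close>

text \<open>One set of supremum lemmas thus serves both components. On the pullback,
  \<open>c0_norm\<close> is applied to bounded sequences that may fail to converge, where it is the
  norm of l_inf.\<close>

lemma c0_norm_eq_CK_norm: "c0_norm s = CK_norm UNIV s"
  by (simp add: c0_norm_def CK_norm_def)

lemma le_CK_norm: "bdd_above ((\<lambda>t. \<bar>f t\<bar>) ` S) \<Longrightarrow> t \<in> S \<Longrightarrow> \<bar>f t\<bar> \<le> CK_norm S f"
  unfolding CK_norm_def by (rule cSUP_upper)

lemma CK_norm_le: "S \<noteq> {} \<Longrightarrow> (\<And>t. t \<in> S \<Longrightarrow> \<bar>f t\<bar> \<le> b) \<Longrightarrow> CK_norm S f \<le> b"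
  unfolding CK_norm_def by (rule cSUP_least)

lemma CK_norm_nonneg:
  assumes "S \<noteq> {}" "bdd_above ((\<lambda>t. \<bar>f t\<bar>) ` S)" shows "0 \<le> CK_norm S f"
proof -
  obtain t where "t \<in> S" using assms by blast
  then show ?thesis using le_CK_norm[OF assms(2), of t] by linarith
qed

lemma bdd_above_abs_scale:
  assumes "bdd_above ((\<lambda>t. \<bar>f t :: real\<bar>) ` S)" shows "bdd_above ((\<lambda>t. \<bar>a * f t\<bar>) ` S)"
proof -
  obtain b where "\<And>t. t \<in> S \<Longrightarrow> \<bar>f t\<bar> \<le> b" using assms by (auto simp: bdd_above_def)
  then show ?thesis by (intro bdd_aboveI2[of _ _ "\<bar>a\<bar> * b"]) (simp add: abs_mult mult_left_mono)
qed

lemma CK_norm_scale: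
  assumes "S \<noteq> {}" "bdd_above ((\<lambda>t. \<bar>f t\<bar>) ` S)"
  shows "CK_norm S (\<lambda>t. a * f t) = \<bar>a\<bar> * CK_norm S f"
proof (cases "a = 0")
  case True
  then show ?thesis using assms by (simp add: CK_norm_def)
next
  case False
  have "CK_norm S (\<lambda>t. a * f t) \<le> \<bar>a\<bar> * CK_norm S f"
    using le_CK_norm[OF assms(2)] by (intro CK_norm_le[OF assms(1)]) (simp add: abs_mult mult_left_mono)
  moreover have "CK_norm S f \<le> CK_norm S (\<lambda>t. a * f t) / \<bar>a\<bar>"
    using le_CK_norm[OF bdd_above_abs_scale[OF assms(2)], of _ a] False
    by (intro CK_norm_le[OF assms(1)]) (simp add: abs_mult pos_le_divide_eq mult.commute)
  ultimately show ?thesis using False by (simp add: pos_le_divide_eq mult.commute)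
qed

lemma CK_norm_add:
  assumes "S \<noteq> {}" "bdd_above ((\<lambda>t. \<bar>f t\<bar>) ` S)" "bdd_above ((\<lambda>t. \<bar>g t\<bar>) ` S)"
  shows "CK_norm S (\<lambda>t. f t + g t) \<le> CK_norm S f + CK_norm S g"
proof (rule CK_norm_le[OF assms(1)])
  fix t assume "t \<in> S"
  then show "\<bar>f t + g t\<bar> \<le> CK_norm S f + CK_norm S g"
    using le_CK_norm[OF assms(2), of t] le_CK_norm[OF assms(3), of t] by linarith
qed

lemma bdd_above_CK:
  assumes "compact K" "f \<in> CK_space K" shows "bdd_above ((\<lambda>t. \<bar>f t\<bar>) ` K)"
proof -
  have "continuous_on K (\<lambda>t. \<bar>f t\<bar>)"
    using assms(2) by (auto simp: CK_space_def intro: continuous_intros)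
  then have "compact ((\<lambda>t. \<bar>f t\<bar>) ` K)" using assms(1) compact_continuous_image by blast
  then show ?thesis by (simp add: bounded_imp_bdd_above compact_imp_bounded)
qed

lemma CK_space_add: "f \<in> CK_space K \<Longrightarrow> g \<in> CK_space K \<Longrightarrow> (\<lambda>t. f t + g t) \<in> CK_space K"
  by (auto simp: CK_space_def intro: continuous_intros)

lemma CK_space_scale: "f \<in> CK_space K \<Longrightarrow> (\<lambda>t. a * f t) \<in> CK_space K"
  by (auto simp: CK_space_def intro: continuous_intros)

lemma CK_space_diff: "f \<in> CK_space K \<Longrightarrow> g \<in> CK_space K \<Longrightarrow> (\<lambda>t. f t - g t) \<in> CK_space K"
  by (auto simp: CK_space_def intro: continuous_intros)

lemma CK_space_0: "(\<lambda>_. 0) \<in> CK_space K"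
  by (simp add: CK_space_def)

lemma abs_le_CK_norm:
  assumes "compact K" "K \<noteq> {}" "f \<in> CK_space K" shows "\<bar>f t\<bar> \<le> CK_norm K f"
  using le_CK_norm[OF bdd_above_CK[OF assms(1,3)]] CK_norm_nonneg[OF assms(2) bdd_above_CK[OF assms(1,3)]]
    assms(3) by (cases "t \<in> K") (auto simp: CK_space_def)

lemma CK_norm_le_global: "K \<noteq> {} \<Longrightarrow> (\<And>t. \<bar>f t\<bar> \<le> b) \<Longrightarrow> CK_norm K f \<le> b"
  by (rule CK_norm_le)

lemma uniformly_Cauchy_limit:
  fixes F :: "nat \<Rightarrow> 'b \<Rightarrow> real"
  assumes "\<And>e. e > 0 \<Longrightarrow> \<exists>M. \<forall>m\<ge>M. \<forall>n\<ge>M. \<forall>t. \<bar>F m t - F n t\<bar> < e"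
  shows "\<exists>l. \<forall>e>0. \<exists>M. \<forall>n\<ge>M. \<forall>t. \<bar>F n t - l t\<bar> < e"
proof -
  have "uniformly_Cauchy_on UNIV F"
    unfolding uniformly_Cauchy_on_def dist_real_def using assms by blast
  then obtain l where "uniform_limit UNIV F l sequentially"
    using Cauchy_uniformly_convergent unfolding uniformly_convergent_on_def by blast
  then show ?thesis
    by (intro exI[of _ l]) (simp add: uniform_limit_sequentially_iff dist_real_def)
qed

lemma CK_space_uniform_limit:
  fixes F :: "nat \<Rightarrow> 'a::topological_space \<Rightarrow> real"
  assumes "\<And>n. F n \<in> CK_space K" "\<forall>e>0. \<exists>M. \<forall>n\<ge>M. \<forall>t. \<bar>F n t - l t\<bar> < (e::real)"
  shows "l \<in> CK_space K"
proof -
  have "uniform_limit K F l sequentially"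
    using assms(2) by (force simp: uniform_limit_sequentially_iff dist_real_def)
  then have "continuous_on K l"
    using assms(1) by (intro uniform_limit_theorem[where F = sequentially and f = F]) (auto simp: CK_space_def)
  moreover have "l t = 0" if "t \<notin> K" for t
  proof (rule ccontr)
    assume "l t \<noteq> 0"
    then obtain M where "\<forall>n\<ge>M. \<forall>t'. \<bar>F n t' - l t'\<bar> < \<bar>l t\<bar>" using assms(2) by force
    then have "\<bar>F M t - l t\<bar> < \<bar>l t\<bar>" by blast
    then show False using assms(1)[of M] that by (simp add: CK_space_def)
  qed
  ultimately show ?thesis by (simp add: CK_space_def)
qed

text \<open>Zabreiko's lemma for \<open>C(K)\<close>, replacing the open mapping theorem.\<close>

lemma countably_subadditive_seminorm_bounded:
  fixes p :: "('a::t2_space \<Rightarrow> real) \<Rightarrow> real"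
  assumes K: "compact K" "K \<noteq> {}"
    and scale: "\<And>a f. f \<in> CK_space K \<Longrightarrow> p (\<lambda>t. a * f t) = \<bar>a\<bar> * p f"
    and add: "\<And>f g. f \<in> CK_space K \<Longrightarrow> g \<in> CK_space K \<Longrightarrow> p (\<lambda>t. f t + g t) \<le> p f + p g"
    and p_nonneg: "\<And>f. f \<in> CK_space K \<Longrightarrow> 0 \<le> p f"
    and count: "\<And>f u. f \<in> CK_space K \<Longrightarrow> (\<And>k. u k \<in> CK_space K) \<Longrightarrow> summable (\<lambda>k. p (u k)) \<Longrightarrow>
      (\<lambda>m. CK_norm K (\<lambda>t. f t - (\<Sum>k<m. u k t))) \<longlonglongrightarrow> 0 \<Longrightarrow> p f \<le> (\<Sum>k. p (u k))"
  shows "\<exists>M. \<forall>f\<in>CK_space K. p f \<le> M * CK_norm K f"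
proof -
  let ?X = "CK_space K" and ?\<nu> = "CK_norm K"
  define d where "d f g = ?\<nu> (\<lambda>t. f t - g t)" for f g :: "'a \<Rightarrow> real"
  have bd: "bdd_above ((\<lambda>t. \<bar>f t\<bar>) ` K)" if "f \<in> ?X" for f using bdd_above_CK[OF K(1) that] .
  note nrm = abs_le_CK_norm[OF K] and nle = CK_norm_le_global[OF K(2)]
  have \<nu>0: "0 \<le> ?\<nu> f" if "f \<in> ?X" for f using CK_norm_nonneg[OF K(2) bd[OF that]] .
  have \<nu>s: "?\<nu> (\<lambda>t. a * f t) = \<bar>a\<bar> * ?\<nu> f" if "f \<in> ?X" for f a
    using CK_norm_scale[OF K(2) bd[OF that]] .
  have \<nu>a: "?\<nu> (\<lambda>t. f t + g t) \<le> ?\<nu> f + ?\<nu> g" if "f \<in> ?X" "g \<in> ?X" for f g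
    using CK_norm_add[OF K(2) bd[OF that(1)] bd[OF that(2)]] .
  \<comment> \<open>Nonnegativity of the distance is demanded for all functions, also for unbounded
    ones, whose supremum is unspecified; hence the value 0 outside the carrier.\<close>
  interpret Metric_space ?X "\<lambda>f g. if f \<in> ?X \<and> g \<in> ?X then d f g else 0"
  proof
    show "0 \<le> (if f \<in> ?X \<and> g \<in> ?X then d f g else 0)" for f g
      using \<nu>0 CK_space_diff by (auto simp: d_def)
    show "(if f \<in> ?X \<and> g \<in> ?X then d f g else 0) = (if g \<in> ?X \<and> f \<in> ?X then d g f else 0)" for f g
      by (simp add: d_def CK_norm_def abs_minus_commute)
    show "((if f \<in> ?X \<and> g \<in> ?X then d f g else 0) = 0) = (f = g)" if "f \<in> ?X" "g \<in> ?X" for f g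
    proof
      assume "(if f \<in> ?X \<and> g \<in> ?X then d f g else 0) = 0"
      then have "?\<nu> (\<lambda>t. f t - g t) = 0" using that by (simp add: d_def)
      then have "f t = g t" for t using nrm[OF CK_space_diff[OF that], of t] by simp
      then show "f = g" by blast
    qed (use K(2) in \<open>simp add: d_def CK_norm_def\<close>)
    show "(if f \<in> ?X \<and> h \<in> ?X then d f h else 0) \<le> (if f \<in> ?X \<and> g \<in> ?X then d f g else 0)
        + (if g \<in> ?X \<and> h \<in> ?X then d g h else 0)" if "f \<in> ?X" "g \<in> ?X" "h \<in> ?X" for f g h
      using \<nu>a[OF CK_space_diff[OF that(1,2)] CK_space_diff[OF that(2,3)]] that by (simp add: d_def)
  qed
  have "mcomplete"
    unfolding mcomplete_def
  proof (intro allI impI)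
    fix F assume F: "MCauchy F"
    then have FX: "F n \<in> ?X" for n by (auto simp: MCauchy_def)
    have "\<exists>M. \<forall>m\<ge>M. \<forall>n\<ge>M. \<forall>t. \<bar>F m t - F n t\<bar> < e" if "e > 0" for e
    proof -
      obtain M where M: "\<forall>m\<ge>M. \<forall>n\<ge>M. d (F m) (F n) < e"
        using F \<open>e > 0\<close> FX unfolding MCauchy_def by auto
      then have "\<bar>F m t - F n t\<bar> < e" if "M \<le> m" "M \<le> n" for m n t
        using nrm[OF CK_space_diff[OF FX[of m] FX[of n]], of t] M that by (force simp: d_def)
      then show ?thesis by blast
    qed
    from uniformly_Cauchy_limit[OF this] obtain l where
      l: "\<forall>e>0. \<exists>M. \<forall>n\<ge>M. \<forall>t. \<bar>F n t - l t\<bar> < e" ..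
    have lX: "l \<in> ?X" using CK_space_uniform_limit[OF FX l] .
    have "limitin mtopology F l sequentially"
      unfolding limit_metric_sequentially
    proof (intro conjI allI impI lX)
      fix e :: real assume "e > 0"
      then obtain M where M: "\<forall>n\<ge>M. \<forall>t. \<bar>F n t - l t\<bar> < e / 2" using l by (meson half_gt_zero)
      have "d (F n) l < e" if "n \<ge> M" for n
      proof -
        have "d (F n) l \<le> e / 2" unfolding d_def using M that by (intro nle) (simp add: less_imp_le)
        then show ?thesis using \<open>e > 0\<close> by simp
      qed
      then show "\<exists>N. \<forall>n\<ge>N. F n \<in> ?X \<and> (if F n \<in> ?X \<and> l \<in> ?X then d (F n) l else 0) < e"
        using FX lX by auto
    qed
    then show "\<exists>x. limitin mtopology F x sequentially" by (rule exI[of _ l])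
  qed
  define E where "E n = {f \<in> ?X. p f \<le> real n}" for n
  have "\<exists>n. mtopology interior_of (mtopology closure_of E n) \<noteq> {}"
  proof (rule ccontr)
    assume "\<not> ?thesis"
    then have "mtopology interior_of \<Union>(range (\<lambda>n. mtopology closure_of E n)) = {}"
      using \<open>mcomplete\<close> by (intro metric_Baire_category_alt) auto
    moreover have "?X \<subseteq> \<Union>(range (\<lambda>n. mtopology closure_of E n))"
    proof
      fix f assume f: "f \<in> ?X"
      obtain n where "p f \<le> real n" using real_arch_simple by blast
      then have "f \<in> E n" using f by (simp add: E_def)
      moreover have "E n \<subseteq> mtopology closure_of E n"
        by (rule closure_of_subset) (auto simp: E_def)
      ultimately show "f \<in> \<Union>(range (\<lambda>n. mtopology closure_of E n))" by blast
    qed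
    then have "?X \<subseteq> mtopology interior_of \<Union>(range (\<lambda>n. mtopology closure_of E n))"
      by (rule interior_of_maximal) (use openin_topspace[of mtopology] in simp)
    ultimately show False using CK_space_0 by blast
  qed
  then obtain n f0 where "f0 \<in> mtopology interior_of (mtopology closure_of E n)" by blast
  then obtain U where "openin mtopology U" "f0 \<in> U" "U \<subseteq> mtopology closure_of E n"
    by (auto simp: interior_of_def)
  then obtain r where r: "r > 0" "mball f0 r \<subseteq> mtopology closure_of E n" and f0: "f0 \<in> ?X"
    unfolding openin_mtopology by blast
  have near: "\<exists>u\<in>?X. p u \<le> real n \<and> d f u < e" if "f \<in> mball f0 r" "e > 0" for f e
  proof -
    have "f \<in> mtopology closure_of E n" using r that by blast
    then obtain u where "u \<in> E n" "u \<in> mball f e"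
      using \<open>e > 0\<close> unfolding metric_closure_of by blast
    then show ?thesis by (auto simp: E_def in_mball)
  qed
  \<comment> \<open>The ball is moved from \<open>f0\<close> to the origin: half the difference of
    approximants to \<open>f0 + g\<close> and \<open>f0 - g\<close> approximates \<open>g\<close>,
    and homogeneity with subadditivity keeps the bound \<open>real n\<close>.\<close>
  have step1: "\<exists>u\<in>?X. p u \<le> real n \<and> ?\<nu> (\<lambda>t. g t - u t) < e" if g: "g \<in> ?X" "?\<nu> g < r" and e: "e > 0" for g e
  proof -
    have m: "(\<lambda>t. f0 t + g t) \<in> mball f0 r" "(\<lambda>t. f0 t + - 1 * g t) \<in> mball f0 r"
      using g f0 CK_space_add[OF f0 g(1)] CK_space_add[OF f0 CK_space_scale[OF g(1), of "- 1"]]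
      by (auto simp: in_mball d_def CK_norm_def)
    obtain u1 where u1: "u1 \<in> ?X" "p u1 \<le> real n" "d (\<lambda>t. f0 t + g t) u1 < e" using near[OF m(1) e] by blast
    obtain u2 where u2: "u2 \<in> ?X" "p u2 \<le> real n" "d (\<lambda>t. f0 t + - 1 * g t) u2 < e" using near[OF m(2) e] by blast
    define u where "u = (\<lambda>t. 1 / 2 * u1 t + (- 1 / 2) * u2 t)"
    have uX: "u \<in> ?X" unfolding u_def by (intro CK_space_add CK_space_scale u1 u2)
    have "p u \<le> p (\<lambda>t. 1 / 2 * u1 t) + p (\<lambda>t. (- 1 / 2) * u2 t)"
      unfolding u_def by (intro add CK_space_scale u1 u2)
    also have "\<dots> \<le> real n" using scale[OF u1(1), of "1 / 2"] scale[OF u2(1), of "- 1 / 2"] u1 u2 by simp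
    finally have pu: "p u \<le> real n" .
    have "\<bar>g t - u t\<bar> \<le> (d (\<lambda>t. f0 t + g t) u1 + d (\<lambda>t. f0 t + - 1 * g t) u2) / 2" for t
    proof -
      have "\<bar>f0 t + g t - u1 t\<bar> \<le> d (\<lambda>t. f0 t + g t) u1"
        unfolding d_def by (rule nrm[OF CK_space_diff[OF CK_space_add[OF f0 g(1)] u1(1)]])
      moreover have "\<bar>f0 t + - 1 * g t - u2 t\<bar> \<le> d (\<lambda>t. f0 t + - 1 * g t) u2"
        unfolding d_def
        by (rule nrm[OF CK_space_diff[OF CK_space_add[OF f0 CK_space_scale[OF g(1)]] u2(1)]])
      moreover have "g t - u t = ((f0 t + g t - u1 t) - (f0 t + - 1 * g t - u2 t)) / 2"
        by (simp add: u_def field_simps)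
      moreover have "\<bar>x\<bar> \<le> (A + B) / 2" if "\<bar>b\<bar> \<le> A" "\<bar>c\<bar> \<le> B" "x = (b - c) / 2"
        for x b c A B :: real
        using that by (auto simp: abs_le_iff)
      ultimately show ?thesis by blast
    qed
    then have "?\<nu> (\<lambda>t. g t - u t) \<le> (d (\<lambda>t. f0 t + g t) u1 + d (\<lambda>t. f0 t + - 1 * g t) u2) / 2"
      by (rule nle)
    then show ?thesis using uX pu u1(3) u2(3) by (intro bexI[of _ u]) auto
  qed
  have step: "\<exists>u\<in>?X. p u \<le> real n * (1 / 2) ^ k \<and> ?\<nu> (\<lambda>t. g t - u t) < r * (1 / 2) ^ Suc k"
    if g: "g \<in> ?X" "?\<nu> g < r * (1 / 2) ^ k" for g k
  proof -
    have "?\<nu> (\<lambda>t. 2 ^ k * g t) < r" using g \<nu>s[OF g(1), of "2 ^ k"] by (simp add: field_simps)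
    then obtain v where v: "v \<in> ?X" "p v \<le> real n" "?\<nu> (\<lambda>t. 2 ^ k * g t - v t) < r / 2"
      using step1[OF CK_space_scale[OF g(1)], of "2 ^ k" "r / 2"] r by auto
    have "?\<nu> (\<lambda>t. g t - (1 / 2) ^ k * v t) = ?\<nu> (\<lambda>t. (1 / 2) ^ k * (2 ^ k * g t - v t))"
      by (simp add: algebra_simps flip: power_mult_distrib)
    also have "\<dots> = (1 / 2) ^ k * ?\<nu> (\<lambda>t. 2 ^ k * g t - v t)"
      using \<nu>s[OF CK_space_diff[OF CK_space_scale[OF g(1)] v(1)]] by simp
    also have "\<dots> < (1 / 2) ^ k * (r / 2)" using v(3) by (intro mult_strict_left_mono) auto
    finally have "?\<nu> (\<lambda>t. g t - (1 / 2) ^ k * v t) < r * (1 / 2) ^ Suc k" by (simp add: mult_ac)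
    moreover have "p (\<lambda>t. (1 / 2) ^ k * v t) \<le> real n * (1 / 2) ^ k"
      using scale[OF v(1), of "(1 / 2) ^ k"] v(2) by (simp add: mult.commute)
    ultimately show ?thesis using CK_space_scale[OF v(1)] by blast
  qed
  have small: "p f \<le> 2 * real n" if f: "f \<in> ?X" "?\<nu> f < r" for f
  proof -
    have "\<forall>q. \<exists>u. fst q \<in> ?X \<and> ?\<nu> (fst q) < r * (1 / 2) ^ snd q \<longrightarrow>
        u \<in> ?X \<and> p u \<le> real n * (1 / 2) ^ snd q \<and> ?\<nu> (\<lambda>t. fst q t - u t) < r * (1 / 2) ^ Suc (snd q)"
      using step by blast
    from choice[OF this] obtain S where S: "\<forall>q. fst q \<in> ?X \<and> ?\<nu> (fst q) < r * (1 / 2) ^ snd q \<longrightarrow>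
        S q \<in> ?X \<and> p (S q) \<le> real n * (1 / 2) ^ snd q \<and>
        ?\<nu> (\<lambda>t. fst q t - S q t) < r * (1 / 2) ^ Suc (snd q)" ..
    \<comment> \<open>\<open>G k\<close> is the remainder after \<open>k\<close> approximation
      steps; its norm bound halves each time, as do the bounds on \<open>p\<close> of the
      approximants, so \<open>count\<close> applies with a geometric majorant of sum
      \<open>2 * real n\<close>.\<close>
    define G where "G = rec_nat f (\<lambda>k g t. g t - S (g, k) t)"
    have G0: "G 0 = f" and GS: "G (Suc k) = (\<lambda>t. G k t - S (G k, k) t)" for k
      by (auto simp: G_def)
    have G: "G k \<in> ?X \<and> ?\<nu> (G k) < r * (1 / 2) ^ k" for k
    proof (induction k)
      case (Suc k)
      then show ?case using S[rule_format, of "(G k, k)"] by (simp add: GS CK_space_diff)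
    qed (use f G0 in simp)
    define u where "u k = S (G k, k)" for k
    have u: "u k \<in> ?X" "p (u k) \<le> real n * (1 / 2) ^ k" for k
      using S[rule_format, of "(G k, k)"] G[of k] by (auto simp: u_def)
    have geo: "summable (\<lambda>k. real n * (1 / 2) ^ k)" by (intro summable_mult) (simp add: summable_geometric)
    have summ: "summable (\<lambda>k. p (u k))"
      by (rule summable_comparison_test'[OF geo, of 0]) (use u(2) p_nonneg[OF u(1)] in simp)
    have "(\<lambda>t. f t - (\<Sum>k<m. u k t)) = G m" for m
      by (induction m) (auto simp: G0 GS u_def algebra_simps fun_eq_iff)
    moreover have "(\<lambda>m. ?\<nu> (G m)) \<longlonglongrightarrow> 0"
    proof (rule tendsto_sandwich)
      show "\<forall>\<^sub>F m in sequentially. 0 \<le> ?\<nu> (G m)" using G \<nu>0 by simp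
      show "\<forall>\<^sub>F m in sequentially. ?\<nu> (G m) \<le> r * (1 / 2) ^ m" using G by (simp add: less_imp_le)
      show "(\<lambda>m. r * (1 / 2) ^ m) \<longlonglongrightarrow> 0"
        by (intro tendsto_mult_right_zero LIMSEQ_realpow_zero) auto
    qed simp
    ultimately have "p f \<le> (\<Sum>k. p (u k))" using count[OF f(1) u(1) summ] by simp
    also have "\<dots> \<le> (\<Sum>k. real n * (1 / 2) ^ k)" by (intro suminf_le u summ geo)
    also have "\<dots> = 2 * real n" by (subst suminf_mult) (auto simp: suminf_geometric summable_geometric)
    finally show ?thesis .
  qed
  have "p f \<le> 4 * real n / r * ?\<nu> f" if f: "f \<in> ?X" for f
  proof (cases "?\<nu> f = 0")
    case True
    have "f t = 0" for t using nrm[OF f, of t] True by simp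
    then have "f = (\<lambda>t. 0 * f t)" by auto
    then have "p f = 0" using scale[OF f, of 0] by simp
    then show ?thesis using True by simp
  next
    case False
    then have pos: "?\<nu> f > 0" using \<nu>0[OF f] by simp
    \<comment> \<open>The factor 2 brings the norm of \<open>a * f\<close> to \<open>r / 2\<close>,
      strictly inside the ball, and turns the bound \<open>2 * real n\<close> into the constant
      \<open>4 * real n / r\<close>.\<close>
    define a where "a = r / (2 * ?\<nu> f)"
    have a: "a > 0" using pos r by (simp add: a_def)
    have "?\<nu> (\<lambda>t. a * f t) < r" using \<nu>s[OF f, of a] a pos r by (simp add: a_def)
    then have "a * p f \<le> 2 * real n" using small[OF CK_space_scale[OF f, of a]] scale[OF f, of a] a by simp
    then show ?thesis using pos r by (simp add: a_def field_simps)
  qed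
  then show ?thesis by blast
qed

section \<open>The twisted sum\<close>

definition pair_add :: "('b \<Rightarrow> real) \<times> ('a \<Rightarrow> real) \<Rightarrow> ('b \<Rightarrow> real) \<times> ('a \<Rightarrow> real) \<Rightarrow> ('b \<Rightarrow> real) \<times> ('a \<Rightarrow> real)"
  where "pair_add z w = (\<lambda>n. fst z n + fst w n, \<lambda>t. snd z t + snd w t)"

definition pair_scale :: "real \<Rightarrow> ('b \<Rightarrow> real) \<times> ('a \<Rightarrow> real) \<Rightarrow> ('b \<Rightarrow> real) \<times> ('a \<Rightarrow> real)"
  where "pair_scale a z = (\<lambda>n. a * fst z n, \<lambda>t. a * snd z t)"

definition pair_norm :: "'a set \<Rightarrow> (nat \<Rightarrow> real) \<times> ('a \<Rightarrow> real) \<Rightarrow> real"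
  where "pair_norm K z = c0_norm (fst z) + CK_norm K (snd z)"

lemma eventually_not_mem_finite: "finite (S :: nat set) \<Longrightarrow> \<forall>\<^sub>F k in sequentially. k \<notin> S"
  by (simp add: eventually_cofinite flip: cofinite_eq_sequentially)

context null_system
begin

lemma K_nonempty: "K \<noteq> {}" using yK by blast

definition \<alpha> :: "nat \<times> (nat \<Rightarrow> nat) \<Rightarrow> ('a \<Rightarrow> real) \<Rightarrow> real" where "\<alpha> p f = f (y p) - f (z p)"

definition \<tau> :: "(nat \<times> (nat \<Rightarrow> nat)) set \<Rightarrow> ('a \<Rightarrow> real) \<Rightarrow> nat \<Rightarrow> real" where
  "\<tau> E f k = (\<Sum>p\<in>E. if k \<in> branch p then \<alpha> p f else 0)"

text \<open>\<open>lifts f s\<close> says that \<open>s\<close> represents in \<open>\<ell>\<^sub>\<infinity>/c\<^sub>0\<close> the norm convergent sum of the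
  \<open>\<alpha> p f\<close> times the class of the indicator function of \<open>branch p\<close>.\<close>

definition lifts :: "('a \<Rightarrow> real) \<Rightarrow> (nat \<Rightarrow> real) \<Rightarrow> bool" where
  "lifts f s \<longleftrightarrow> (\<forall>e>0. \<forall>\<^sub>F E in finite_subsets_at_top UNIV.
    \<forall>\<^sub>F k in sequentially. \<bar>s k - \<tau> E f k\<bar> < e)"

section \<open>Linearity of the lifting relation\<close>

lemma \<alpha>_add: "\<alpha> p (\<lambda>t. f t + g t) = \<alpha> p f + \<alpha> p g" by (simp add: \<alpha>_def)
lemma \<alpha>_scale: "\<alpha> p (\<lambda>t. a * f t) = a * \<alpha> p f" by (simp add: \<alpha>_def algebra_simps)
lemma \<tau>_add: "\<tau> E (\<lambda>t. f t + g t) k = \<tau> E f k + \<tau> E g k"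
  unfolding \<tau>_def by (subst sum.distrib[symmetric]) (intro sum.cong, auto simp: \<alpha>_add)
lemma \<tau>_scale: "\<tau> E (\<lambda>t. a * f t) k = a * \<tau> E f k"
  unfolding \<tau>_def by (subst sum_distrib_left) (intro sum.cong, auto simp: \<alpha>_scale)

lemma lifts_add:
  assumes "lifts f s" "lifts g r" shows "lifts (\<lambda>t. f t + g t) (\<lambda>k. s k + r k)"
  unfolding lifts_def
proof (intro allI impI)
  fix e :: real assume "e > 0"
  then have "\<forall>\<^sub>F E in finite_subsets_at_top UNIV. \<forall>\<^sub>F k in sequentially. \<bar>s k - \<tau> E f k\<bar> < e / 2"
    "\<forall>\<^sub>F E in finite_subsets_at_top UNIV. \<forall>\<^sub>F k in sequentially. \<bar>r k - \<tau> E g k\<bar> < e / 2"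
    using assms unfolding lifts_def by (meson half_gt_zero)+
  then show "\<forall>\<^sub>F E in finite_subsets_at_top UNIV. \<forall>\<^sub>F k in sequentially.
      \<bar>s k + r k - \<tau> E (\<lambda>t. f t + g t) k\<bar> < e"
  proof eventually_elim
    case (elim E)
    then show ?case
    proof eventually_elim
      case (elim k)
      then show ?case unfolding \<tau>_add by linarith
    qed
  qed
qed

lemma lifts_scale:
  assumes "lifts f s" shows "lifts (\<lambda>t. a * f t) (\<lambda>k. a * s k)"
  unfolding lifts_def
proof (intro allI impI)
  fix e :: real assume "e > 0"
  then have "e / (\<bar>a\<bar> + 1) > 0" by simp
  then have "\<forall>\<^sub>F E in finite_subsets_at_top UNIV. \<forall>\<^sub>F k in sequentially. \<bar>s k - \<tau> E f k\<bar> < e / (\<bar>a\<bar> + 1)"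
    using assms unfolding lifts_def by blast
  then show "\<forall>\<^sub>F E in finite_subsets_at_top UNIV. \<forall>\<^sub>F k in sequentially.
      \<bar>a * s k - \<tau> E (\<lambda>t. a * f t) k\<bar> < e"
  proof eventually_elim
    case (elim E)
    then show ?case
    proof eventually_elim
      case (elim k)
      have "\<bar>a * s k - \<tau> E (\<lambda>t. a * f t) k\<bar> = \<bar>a\<bar> * \<bar>s k - \<tau> E f k\<bar>"
        by (simp add: \<tau>_scale abs_mult flip: right_diff_distrib)
      also have "\<dots> \<le> (\<bar>a\<bar> + 1) * \<bar>s k - \<tau> E f k\<bar>" by (intro mult_right_mono) auto
      also have "\<dots> < e" using elim by (simp add: pos_less_divide_eq mult.commute)
      finally show ?case .
    qed
  qed
qed

text \<open>This gives exactness at the middle term: the fibre over zero is c_0.\<close>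

lemma lifts_0: "lifts (\<lambda>_. 0) s \<longleftrightarrow> s \<longlonglongrightarrow> 0"
proof -
  have "\<tau> E (\<lambda>_. 0) k = 0" for E k by (auto simp: \<tau>_def \<alpha>_def intro: sum.neutral)
  then show ?thesis
    by (auto simp: lifts_def tendsto_iff dist_real_def eventually_const_iff
        trivial_limit_def[symmetric] finite_subsets_at_top_neq_bot)
qed

text \<open>Beyond finitely many finite intersections, \<open>\<tau> E f k\<close> has at most one
  nonzero term; modulo c_0 its norm is therefore controlled by the largest coefficient rather than
  by a sum.\<close>

lemma eventually_almost_disjoint:
  assumes "finite E"
  shows "\<forall>\<^sub>F k in sequentially. \<forall>p\<in>E. \<forall>p'\<in>E. k \<in> branch p \<and> k \<in> branch p' \<longrightarrow> p = p'"
proof -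
  have "finite (\<Union>(p, p')\<in>{q \<in> E \<times> E. fst q \<noteq> snd q}. branch p \<inter> branch p')"
    using assms finite_branch_inter by (intro finite_UN_I) auto
  from eventually_not_mem_finite[OF this] show ?thesis
    by eventually_elim fastforce
qed

lemma \<tau>_unique:
  assumes "finite E" "\<forall>p\<in>E. \<forall>p'\<in>E. k \<in> branch p \<and> k \<in> branch p' \<longrightarrow> p = p'"
    "p \<in> E" "k \<in> branch p"
  shows "\<tau> E f k = \<alpha> p f"
proof -
  have "\<tau> E f k = (\<Sum>p'\<in>E. if p' = p then \<alpha> p f else 0)"
    unfolding \<tau>_def using assms by (intro sum.cong) auto
  then show ?thesis using assms by simp
qed

lemma \<tau>_none: "\<forall>p\<in>E. k \<notin> branch p \<Longrightarrow> \<tau> E f k = 0"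
  unfolding \<tau>_def by (intro sum.neutral) auto

lemma eventually_\<tau>_le:
  assumes "finite E" "0 \<le> c" "\<And>p. \<bar>\<alpha> p f\<bar> \<le> c"
  shows "\<forall>\<^sub>F k in sequentially. \<bar>\<tau> E f k\<bar> \<le> c"
  using eventually_almost_disjoint[OF assms(1)]
proof eventually_elim
  case (elim k)
  then show ?case
    using \<tau>_unique[OF assms(1) elim] \<tau>_none[of E k f] assms(2,3) by (metis abs_zero)
qed

text \<open>Once \<open>p\<close> is put into the finite set, the partial sum equals
  \<open>\<alpha> p f\<close> at all late places of the branch. Every lift of \<open>f\<close> is
  thus pinned down along \<open>branch p\<close>.\<close>

lemma lifts_along_branch:
  assumes "lifts f s" "e > 0"
  shows "\<forall>\<^sub>F k in sequentially. k \<in> branch p \<longrightarrow> \<bar>s k - \<alpha> p f\<bar> < e"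
proof -
  have "\<forall>\<^sub>F E in finite_subsets_at_top UNIV. \<forall>\<^sub>F k in sequentially. \<bar>s k - \<tau> E f k\<bar> < e"
    using assms unfolding lifts_def by blast
  then obtain E0 where E0: "finite E0"
      "\<forall>E. finite E \<and> E0 \<subseteq> E \<longrightarrow> (\<forall>\<^sub>F k in sequentially. \<bar>s k - \<tau> E f k\<bar> < e)"
    unfolding eventually_finite_subsets_at_top by auto
  let ?E = "insert p E0"
  have E: "finite ?E" using E0 by simp
  have "\<forall>\<^sub>F k in sequentially. \<bar>s k - \<tau> ?E f k\<bar> < e" using E0(2) E by blast
  with eventually_almost_disjoint[OF E] show ?thesis
  proof eventually_elim
    case (elim k)
    then show ?case using \<tau>_unique[OF E elim(1), of p f] by auto
  qed
qed

text \<open>Summing all terms at a place \<open>k\<close> is not possible, since infinitely many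
  branches pass through \<open>k\<close> and a null family may fail to be summable. Instead
  \<open>s k\<close> is the coefficient of largest modulus among the branches through
  \<open>k\<close>, which exists by \<open>null\<close>.\<close>

lemma ex_lifts:
  assumes f: "f \<in> CK_space K" shows "\<exists>s. lifts f s"
proof -
  have "\<exists>M. k \<in> branch M \<and> (\<forall>p. k \<in> branch p \<longrightarrow> \<bar>\<alpha> p f\<bar> \<le> \<bar>\<alpha> M f\<bar>)" if "k \<in> branch p1" for k p1
  proof (cases "\<forall>p. k \<in> branch p \<longrightarrow> \<alpha> p f = 0")
    case True
    then show ?thesis using that by (intro exI[of _ p1]) auto
  next
    case False
    then obtain q where q: "k \<in> branch q" "\<bar>\<alpha> q f\<bar> > 0" by auto
    let ?S = "{p. k \<in> branch p \<and> \<bar>\<alpha> q f\<bar> \<le> \<bar>\<alpha> p f\<bar>}"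
    have fin: "finite ?S"
      using null[OF f q(2)] unfolding \<alpha>_def by (rule rev_finite_subset) auto
    have ne: "?S \<noteq> {}" using q by blast
    obtain M where M: "M \<in> ?S" "\<bar>\<alpha> M f\<bar> = Max ((\<lambda>p. \<bar>\<alpha> p f\<bar>) ` ?S)"
      using Max_in[of "(\<lambda>p. \<bar>\<alpha> p f\<bar>) ` ?S"] fin ne by (auto simp del: Max_in)
    have "\<bar>\<alpha> p f\<bar> \<le> \<bar>\<alpha> M f\<bar>" if p: "k \<in> branch p" for p
    proof (cases "p \<in> ?S")
      case True
      then show ?thesis unfolding M(2) using fin by (intro Max_ge) auto
    next
      case False
      then show ?thesis using p M(1) by auto
    qed
    then show ?thesis using M(1) by blast
  qed
  then have "\<forall>k. \<exists>M. (\<exists>p. k \<in> branch p) \<longrightarrow>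
      k \<in> branch M \<and> (\<forall>p. k \<in> branch p \<longrightarrow> \<bar>\<alpha> p f\<bar> \<le> \<bar>\<alpha> M f\<bar>)" by blast
  from choice[OF this] obtain M where M: "\<forall>k. (\<exists>p. k \<in> branch p) \<longrightarrow>
      k \<in> branch (M k) \<and> (\<forall>p. k \<in> branch p \<longrightarrow> \<bar>\<alpha> p f\<bar> \<le> \<bar>\<alpha> (M k) f\<bar>)" ..
  define s where "s k = (if \<exists>p. k \<in> branch p then \<alpha> (M k) f else 0)" for k
  have "lifts f s"
    unfolding lifts_def eventually_finite_subsets_at_top
  proof (intro allI impI)
    fix e :: real assume e: "e > 0"
    \<comment> \<open>Coefficients outside \<open>E\<close> are below \<open>e / 2\<close>. If a
      branch of \<open>E\<close> passes through \<open>k\<close>, then \<open>M k\<close> is either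
      that branch or lies outside \<open>E\<close>; in the latter case its coefficient is below
      \<open>e / 2\<close> and dominates the one from \<open>E\<close>, so the error is still below
      \<open>e\<close>.\<close>
    let ?E0 = "{p. e / 2 \<le> \<bar>\<alpha> p f\<bar>}"
    have fin: "finite ?E0" using null[OF f, of "e / 2"] e by (simp add: \<alpha>_def)
    have "\<forall>\<^sub>F k in sequentially. \<bar>s k - \<tau> E f k\<bar> < e" if E: "finite E" "?E0 \<subseteq> E" for E
      using eventually_almost_disjoint[OF E(1)]
    proof eventually_elim
      case (elim k)
      have out: "\<bar>\<alpha> p f\<bar> < e / 2" if "p \<notin> E" for p using that E(2) by force
      show ?case
      proof (cases "\<exists>p\<in>E. k \<in> branch p")
        case True
        then obtain p where p: "p \<in> E" "k \<in> branch p" by blast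
        have Mk: "k \<in> branch (M k)" "\<bar>\<alpha> p f\<bar> \<le> \<bar>\<alpha> (M k) f\<bar>" using M p by blast+
        have "\<exists>p. k \<in> branch p" using p by blast
        then have sk: "s k = \<alpha> (M k) f" by (simp only: s_def if_True)
        have t: "\<tau> E f k = \<alpha> p f" by (rule \<tau>_unique[OF E(1) elim p])
        show ?thesis
        proof (cases "M k \<in> E")
          case True
          then have "M k = p" using elim Mk p by blast
          then show ?thesis using sk t e by simp
        next
          case False
          then show ?thesis using out[OF False] Mk(2) sk t by linarith
        qed
      next
        case False
        then have t: "\<tau> E f k = 0" by (intro \<tau>_none) blast
        show ?thesis
        proof (cases "\<exists>p. k \<in> branch p")
          case True
          then have "k \<in> branch (M k)" using M by blast
          then have "M k \<notin> E" using False by blast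
          then have "\<bar>\<alpha> (M k) f\<bar> < e / 2" by (rule out)
          moreover have "s k = \<alpha> (M k) f" using True by (simp only: s_def if_True)
          ultimately show ?thesis using t e by linarith
        qed (use t e in \<open>simp add: s_def\<close>)
      qed
    qed
    then show "\<exists>X. finite X \<and> X \<subseteq> UNIV \<and> (\<forall>E. finite E \<and> X \<subseteq> E \<and> E \<subseteq> UNIV \<longrightarrow>
        (\<forall>\<^sub>F k in sequentially. \<bar>s k - \<tau> E f k\<bar> < e))"
      using fin by (intro exI[of _ ?E0]) auto
  qed
  then show ?thesis by (rule exI[of _ s])
qed

lemma lifts_bdd:
  assumes "lifts f s" shows "bdd_above (range (\<lambda>k. \<bar>s k\<bar>))"
proof -
  obtain E where "\<forall>\<^sub>F k in sequentially. \<bar>s k - \<tau> E f k\<bar> < 1"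
    using assms unfolding lifts_def eventually_finite_subsets_at_top by (meson order_refl zero_less_one)
  then obtain N where N: "\<And>k. k \<ge> N \<Longrightarrow> \<bar>s k - \<tau> E f k\<bar> < 1" by (auto simp: eventually_sequentially)
  have \<tau>: "\<bar>\<tau> E f k\<bar> \<le> (\<Sum>p\<in>E. \<bar>\<alpha> p f\<bar>)" for k
    unfolding \<tau>_def by (rule order_trans[OF sum_abs]) (intro sum_mono, auto)
  have "\<bar>s k\<bar> \<le> (\<Sum>k<N. \<bar>s k\<bar>) + (1 + (\<Sum>p\<in>E. \<bar>\<alpha> p f\<bar>))" for k
  proof (cases "k < N")
    case True
    then have "\<bar>s k\<bar> \<le> (\<Sum>k<N. \<bar>s k\<bar>)" by (intro member_le_sum) auto
    moreover have "0 \<le> (\<Sum>p\<in>E. \<bar>\<alpha> p f\<bar>)" by (intro sum_nonneg) auto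
    ultimately show ?thesis by linarith
  next
    case False
    then have "\<bar>s k - \<tau> E f k\<bar> < 1" using N by simp
    moreover have "0 \<le> (\<Sum>k<N. \<bar>s k\<bar>)" by (intro sum_nonneg) auto
    ultimately show ?thesis using \<tau>[of k] by linarith
  qed
  then show ?thesis by (intro bdd_aboveI2)
qed

text \<open>Completeness of the pullback rests on this closedness, which comes from boundedness of
  the operator: a uniformly small function has uniformly small coefficients, and by almost
  disjointness its partial sums are small far out.\<close>

lemma lifts_uniform_limit:
  fixes F :: "nat \<Rightarrow> _" and S :: "nat \<Rightarrow> _"
  assumes "\<And>n. lifts (F n) (S n)"
    and F: "\<forall>e>0. \<exists>M. \<forall>n\<ge>M. \<forall>t. \<bar>F n t - f t\<bar> < e"
    and S: "\<forall>e>0. \<exists>M. \<forall>n\<ge>M. \<forall>k. \<bar>S n k - s k\<bar> < e"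
  shows "lifts f s"
  unfolding lifts_def
proof (intro allI impI)
  fix e :: real assume "e > 0"
  \<comment> \<open>Two errors of \<open>e / 4\<close> involve \<open>S n\<close>; the partial sum
    of the difference contributes \<open>e / 2\<close>, each of its coefficients being a difference
    of two values below \<open>e / 4\<close>.\<close>
  then have e: "e / 4 > 0" by simp
  obtain M1 where M1: "\<forall>n\<ge>M1. \<forall>t. \<bar>F n t - f t\<bar> < e / 4" using F e by blast
  obtain M2 where M2: "\<forall>n\<ge>M2. \<forall>k. \<bar>S n k - s k\<bar> < e / 4" using S e by blast
  define n where "n = max M1 M2"
  have n: "\<bar>F n t - f t\<bar> < e / 4" "\<bar>S n k - s k\<bar> < e / 4" for t k
  proof -
    have "M1 \<le> n" "M2 \<le> n" by (simp_all add: n_def)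
    then show "\<bar>F n t - f t\<bar> < e / 4" "\<bar>S n k - s k\<bar> < e / 4" using M1 M2 by blast+
  qed
  define g where "g t = f t + - 1 * F n t" for t
  have g: "\<bar>\<alpha> p g\<bar> \<le> e / 2" for p
    using n(1)[of "y p"] n(1)[of "z p"] unfolding \<alpha>_def g_def by linarith
  have "\<forall>\<^sub>F E in finite_subsets_at_top UNIV. \<forall>\<^sub>F k in sequentially. \<bar>S n k - \<tau> E (F n) k\<bar> < e / 4"
    using assms(1)[of n] e unfolding lifts_def by blast
  moreover have "\<forall>\<^sub>F E in finite_subsets_at_top UNIV. finite E"
    by (simp add: eventually_finite_subsets_at_top_weakI)
  ultimately show "\<forall>\<^sub>F E in finite_subsets_at_top UNIV. \<forall>\<^sub>F k in sequentially. \<bar>s k - \<tau> E f k\<bar> < e"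
  proof eventually_elim
    case (elim E)
    have "\<forall>\<^sub>F k in sequentially. \<bar>\<tau> E g k\<bar> \<le> e / 2"
      using elim(2) \<open>e > 0\<close> g by (intro eventually_\<tau>_le) auto
    with elim(1) show ?case
    proof eventually_elim
      case (elim k)
      have "\<tau> E g k = \<tau> E f k - \<tau> E (F n) k"
        unfolding g_def \<tau>_add \<tau>_scale by simp
      then show ?case using elim n(2)[of k] by linarith
    qed
  qed
qed

section \<open>The pullback as a Banach space\<close>

definition Z :: "((nat \<Rightarrow> real) \<times> ('a \<Rightarrow> real)) set" where
  "Z = {w. snd w \<in> CK_space K \<and> lifts (snd w) (fst w)}"

lemma abs_le_pair_norm:
  assumes "w \<in> Z" shows "\<bar>fst w k\<bar> \<le> pair_norm K w" "\<bar>snd w t\<bar> \<le> pair_norm K w"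
    "c0_norm (fst w) \<le> pair_norm K w" "CK_norm K (snd w) \<le> pair_norm K w" "0 \<le> pair_norm K w"
proof -
  have b: "bdd_above (range (\<lambda>k. \<bar>fst w k\<bar>))" and C: "snd w \<in> CK_space K"
    using assms lifts_bdd by (auto simp: Z_def)
  have "\<bar>fst w k\<bar> \<le> c0_norm (fst w)" "0 \<le> c0_norm (fst w)"
    unfolding c0_norm_eq_CK_norm using le_CK_norm[OF b] CK_norm_nonneg[OF _ b] by auto
  moreover have "\<bar>snd w t\<bar> \<le> CK_norm K (snd w)" "0 \<le> CK_norm K (snd w)"
    using abs_le_CK_norm[OF compact K_nonempty C] CK_norm_nonneg[OF K_nonempty bdd_above_CK[OF compact C]] by auto
  ultimately show "\<bar>fst w k\<bar> \<le> pair_norm K w" "\<bar>snd w t\<bar> \<le> pair_norm K w"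
    "c0_norm (fst w) \<le> pair_norm K w" "CK_norm K (snd w) \<le> pair_norm K w" "0 \<le> pair_norm K w"
    by (auto simp: pair_norm_def)
qed

lemma pair_norm_le: "(\<And>k. \<bar>fst w k\<bar> \<le> a) \<Longrightarrow> (\<And>t. \<bar>snd w t\<bar> \<le> b) \<Longrightarrow> pair_norm K w \<le> a + b"
  unfolding pair_norm_def c0_norm_eq_CK_norm
  by (intro add_mono CK_norm_le K_nonempty) auto

lemma Z_add: "v \<in> Z \<Longrightarrow> w \<in> Z \<Longrightarrow> pair_add v w \<in> Z"
  by (simp add: Z_def pair_add_def CK_space_add lifts_add)

lemma Z_scale: "w \<in> Z \<Longrightarrow> pair_scale a w \<in> Z"
  by (simp add: Z_def pair_scale_def CK_space_scale lifts_scale)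

lemma Z_0: "((\<lambda>_. 0), (\<lambda>_. 0)) \<in> Z"
  by (simp add: Z_def CK_space_0 lifts_0)

lemma Z_bdd:
  assumes "w \<in> Z"
  shows "bdd_above (range (\<lambda>k. \<bar>fst w k\<bar>))" "bdd_above ((\<lambda>t. \<bar>snd w t\<bar>) ` K)"
  using assms lifts_bdd bdd_above_CK[OF compact] by (auto simp: Z_def)

lemma pair_norm_add:
  assumes "v \<in> Z" "w \<in> Z" shows "pair_norm K (pair_add v w) \<le> pair_norm K v + pair_norm K w"
  using CK_norm_add[OF UNIV_not_empty Z_bdd(1)[OF assms(1)] Z_bdd(1)[OF assms(2)]]
    CK_norm_add[OF K_nonempty Z_bdd(2)[OF assms(1)] Z_bdd(2)[OF assms(2)]]
  by (simp add: pair_norm_def pair_add_def c0_norm_eq_CK_norm)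

lemma pair_norm_scale:
  assumes "w \<in> Z" shows "pair_norm K (pair_scale a w) = \<bar>a\<bar> * pair_norm K w"
  using CK_norm_scale[OF UNIV_not_empty Z_bdd(1)[OF assms], of a]
    CK_norm_scale[OF K_nonempty Z_bdd(2)[OF assms], of a]
  by (simp add: pair_norm_def pair_scale_def c0_norm_eq_CK_norm distrib_left)

abbreviation "pair_diff v w \<equiv> pair_add v (pair_scale (- 1) w)"

lemma Z_complete:
  assumes sZ: "\<And>n. s n \<in> Z"
    and Cauchy: "\<forall>e>0. \<exists>M. \<forall>m\<ge>M. \<forall>n\<ge>M. pair_norm K (pair_diff (s m) (s n)) < e"
  shows "\<exists>l\<in>Z. (\<lambda>n. pair_norm K (pair_diff (s n) l)) \<longlonglongrightarrow> 0"
proof -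
  have dZ: "pair_diff (s m) (s n) \<in> Z" for m n by (intro Z_add Z_scale sZ)
  have b: "\<bar>fst (s m) k - fst (s n) k\<bar> \<le> pair_norm K (pair_diff (s m) (s n))"
    "\<bar>snd (s m) t - snd (s n) t\<bar> \<le> pair_norm K (pair_diff (s m) (s n))" for m n k t
    using abs_le_pair_norm(1,2)[OF dZ[of m n]] by (simp_all add: pair_add_def pair_scale_def)
  have "\<exists>M. \<forall>m\<ge>M. \<forall>n\<ge>M. \<forall>k. \<bar>fst (s m) k - fst (s n) k\<bar> < e"
    "\<exists>M. \<forall>m\<ge>M. \<forall>n\<ge>M. \<forall>t. \<bar>snd (s m) t - snd (s n) t\<bar> < e" if "e > 0" for e
    using Cauchy[rule_format, OF that] b by (meson order_le_less_trans)+
  note C = this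
  from uniformly_Cauchy_limit[of "\<lambda>n. fst (s n)", OF C(1)]
  obtain l1 where l1: "\<forall>e>0. \<exists>M. \<forall>n\<ge>M. \<forall>k. \<bar>fst (s n) k - l1 k\<bar> < e" ..
  from uniformly_Cauchy_limit[of "\<lambda>n. snd (s n)", OF C(2)]
  obtain l2 where l2: "\<forall>e>0. \<exists>M. \<forall>n\<ge>M. \<forall>t. \<bar>snd (s n) t - l2 t\<bar> < e" ..
  have sZ': "snd (s n) \<in> CK_space K" "lifts (snd (s n)) (fst (s n))" for n
    using sZ[of n] by (simp_all add: Z_def)
  have "l2 \<in> CK_space K" by (rule CK_space_uniform_limit[OF sZ'(1) l2])
  moreover have "lifts l2 l1"
    by (rule lifts_uniform_limit[OF sZ'(2) l2 l1])
  ultimately have lZ: "(l1, l2) \<in> Z" by (simp add: Z_def)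
  have "(\<lambda>n. pair_norm K (pair_diff (s n) (l1, l2))) \<longlonglongrightarrow> 0"
  proof (rule LIMSEQ_I)
    fix e :: real assume "e > 0"
    then have e: "e / 3 > 0" by simp
    obtain M1 where M1: "\<forall>n\<ge>M1. \<forall>k. \<bar>fst (s n) k - l1 k\<bar> < e / 3" using l1 e by blast
    obtain M2 where M2: "\<forall>n\<ge>M2. \<forall>t. \<bar>snd (s n) t - l2 t\<bar> < e / 3" using l2 e by blast
    have "norm (pair_norm K (pair_diff (s n) (l1, l2)) - 0) < e" if n: "n \<ge> max M1 M2" for n
    proof -
      have "pair_norm K (pair_diff (s n) (l1, l2)) \<le> e / 3 + e / 3"
        using M1 M2 n by (intro pair_norm_le) (auto simp: pair_add_def pair_scale_def intro: less_imp_le)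
      moreover have "0 \<le> pair_norm K (pair_diff (s n) (l1, l2))"
        by (intro abs_le_pair_norm(5) Z_add Z_scale sZ lZ)
      ultimately show ?thesis using \<open>e > 0\<close> by simp
    qed
    then show "\<exists>no. \<forall>n\<ge>no. norm (pair_norm K (pair_diff (s n) (l1, l2)) - 0) < e" by blast
  qed
  with lZ show ?thesis by blast
qed

lemma banach_Z: "banach_on Z pair_add pair_scale ((\<lambda>_. 0), (\<lambda>_. 0)) (pair_norm K)"
  unfolding banach_on_def
proof (intro conjI ballI allI impI)
  show "((\<lambda>_. 0), (\<lambda>_. 0)) \<in> Z" by (rule Z_0)
  show "\<And>v w. v \<in> Z \<Longrightarrow> w \<in> Z \<Longrightarrow> pair_add v w \<in> Z" by (rule Z_add)
  show "\<And>a w. w \<in> Z \<Longrightarrow> pair_scale a w \<in> Z" by (rule Z_scale)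
  show "\<And>v w. v \<in> Z \<Longrightarrow> w \<in> Z \<Longrightarrow> pair_norm K (pair_add v w) \<le> pair_norm K v + pair_norm K w"
    by (rule pair_norm_add)
  show "\<And>a w. w \<in> Z \<Longrightarrow> pair_norm K (pair_scale a w) = \<bar>a\<bar> * pair_norm K w" by (rule pair_norm_scale)
  show "\<And>w. w \<in> Z \<Longrightarrow> 0 \<le> pair_norm K w" by (rule abs_le_pair_norm)
  show "(pair_norm K w = 0) = (w = ((\<lambda>_. 0), (\<lambda>_. 0)))" if "w \<in> Z" for w
  proof
    assume "pair_norm K w = 0"
    then have "fst w = (\<lambda>_. 0)" "snd w = (\<lambda>_. 0)"
      using abs_le_pair_norm(1,2)[OF that] by (auto simp: fun_eq_iff)
    then show "w = ((\<lambda>_. 0), (\<lambda>_. 0))" by (simp add: prod_eq_iff)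
  next
    assume "w = ((\<lambda>_. 0), (\<lambda>_. 0))"
    then show "pair_norm K w = 0" using K_nonempty by (simp add: pair_norm_def c0_norm_def CK_norm_def)
  qed
  fix s :: "nat \<Rightarrow> (nat \<Rightarrow> real) \<times> ('a \<Rightarrow> real)" assume s: "(\<forall>n. s n \<in> Z) \<and>
      (\<forall>e>0. \<exists>M. \<forall>m\<ge>M. \<forall>n\<ge>M. pair_norm K (pair_diff (s m) (s n)) < e)"
  then show "\<exists>l\<in>Z. (\<lambda>n. pair_norm K (pair_diff (s n) l)) \<longlonglongrightarrow> 0" by (intro Z_complete) auto
qed (auto simp: pair_add_def pair_scale_def algebra_simps fun_eq_iff)

section \<open>The extension and its nontriviality\<close>

definition inclusion :: "(nat \<Rightarrow> real) \<Rightarrow> (nat \<Rightarrow> real) \<times> ('a \<Rightarrow> real)" where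
  "inclusion s = (s, (\<lambda>_. 0))"

lemma inclusion_image: "inclusion ` c0_space = {w \<in> Z. snd w = (\<lambda>_. 0)}"
  by (auto simp: inclusion_def c0_space_def Z_def CK_space_0 lifts_0 image_iff prod_eq_iff)

text \<open>A complement \<open>W\<close> has exactly one element over each function in
  \<open>CK_space K\<close>, so it is the graph of a linear section \<open>\<sigma>\<close>, and its
  closedness makes \<open>\<sigma>\<close> bounded.\<close>

lemma not_complemented:
  "\<not> complemented_on Z pair_add pair_scale ((\<lambda>_. 0), (\<lambda>_. 0)) (pair_norm K) (inclusion ` c0_space)"
proof
  assume "complemented_on Z pair_add pair_scale ((\<lambda>_. 0), (\<lambda>_. 0)) (pair_norm K) (inclusion ` c0_space)"
  then obtain W where closed: "closed_subspace_on Z pair_add pair_scale ((\<lambda>_. 0), (\<lambda>_. 0)) (pair_norm K) W"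
    and triv: "inclusion ` c0_space \<inter> W = {((\<lambda>_. 0), (\<lambda>_. 0))}"
    and sum: "\<forall>w\<in>Z. \<exists>c\<in>inclusion ` c0_space. \<exists>v\<in>W. w = pair_add c v"
    unfolding complemented_on_def by blast
  have WZ: "W \<subseteq> Z" and W0: "((\<lambda>_. 0), (\<lambda>_. 0)) \<in> W"
    and Wadd: "\<And>v w. v \<in> W \<Longrightarrow> w \<in> W \<Longrightarrow> pair_add v w \<in> W"
    and Wscale: "\<And>a w. w \<in> W \<Longrightarrow> pair_scale a w \<in> W"
    using closed unfolding closed_subspace_on_def by blast+
  have Wclosed: "l \<in> W" if "\<And>n. s n \<in> W" "l \<in> Z" "(\<lambda>n. pair_norm K (pair_diff (s n) l)) \<longlonglongrightarrow> 0" for s l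
    using closed that unfolding closed_subspace_on_def by blast
  have ex: "\<exists>s. (s, f) \<in> W" if f: "f \<in> CK_space K" for f
  proof -
    obtain s where "lifts f s" using ex_lifts[OF f] by blast
    then have "(s, f) \<in> Z" using f by (simp add: Z_def)
    then obtain c v where "c \<in> inclusion ` c0_space" "v \<in> W" "(s, f) = pair_add c v" using sum by blast
    then have "snd v = f" by (auto simp: inclusion_def pair_add_def)
    then show ?thesis using \<open>v \<in> W\<close> by (metis prod.collapse)
  qed
  have uniq: "s = r" if "(s, f) \<in> W" "(r, f) \<in> W" for s r f
  proof -
    have "pair_diff (s, f) (r, f) \<in> W" by (intro Wadd Wscale that)
    moreover have "snd (pair_diff (s, f) (r, f)) = (\<lambda>_. 0)" by (simp add: pair_add_def pair_scale_def)
    ultimately have "pair_diff (s, f) (r, f) \<in> inclusion ` c0_space \<inter> W"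
      using WZ unfolding inclusion_image by blast
    then have "pair_diff (s, f) (r, f) = ((\<lambda>_. 0), (\<lambda>_. 0))" using triv by blast
    then show ?thesis by (simp add: pair_add_def pair_scale_def fun_eq_iff)
  qed
  have "\<forall>f. \<exists>s. f \<in> CK_space K \<longrightarrow> (s, f) \<in> W" using ex by blast
  from choice[OF this] obtain \<sigma> where \<sigma>: "\<forall>f. f \<in> CK_space K \<longrightarrow> (\<sigma> f, f) \<in> W" ..
  have \<sigma>_eq: "\<sigma> f = s" if "(s, f) \<in> W" for s f
    using that \<sigma> WZ uniq by (auto simp: Z_def)
  have \<sigma>_add: "\<sigma> (\<lambda>t. f t + g t) = (\<lambda>k. \<sigma> f k + \<sigma> g k)" if "f \<in> CK_space K" "g \<in> CK_space K" for f g
    using Wadd[OF \<sigma>[rule_format, OF that(1)] \<sigma>[rule_format, OF that(2)]]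
    by (intro \<sigma>_eq) (simp add: pair_add_def)
  have \<sigma>_scale: "\<sigma> (\<lambda>t. a * f t) = (\<lambda>k. a * \<sigma> f k)" if "f \<in> CK_space K" for f a
    using Wscale[OF \<sigma>[rule_format, OF that], of a] by (intro \<sigma>_eq) (simp add: pair_scale_def)
  have \<sigma>_sum: "(\<lambda>t. \<Sum>i<m. u i t) \<in> CK_space K \<and> \<sigma> (\<lambda>t. \<Sum>i<m. u i t) = (\<lambda>k. \<Sum>i<m. \<sigma> (u i) k)"
    if "\<And>i. u i \<in> CK_space K" for u and m :: nat
  proof (induction m)
    case 0
    then show ?case using \<sigma>_eq[OF W0] by (simp add: CK_space_0)
  next
    case (Suc m)
    then show ?case using \<sigma>_add[OF _ that[of m]] CK_space_add[OF _ that[of m]] by simp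
  qed
  have \<sigma>Z: "(\<sigma> f, f) \<in> Z" if "f \<in> CK_space K" for f using \<sigma> WZ that by blast
  have \<sigma>_bdd: "bdd_above (range (\<lambda>k. \<bar>\<sigma> f k\<bar>))" if "f \<in> CK_space K" for f
    using Z_bdd(1)[OF \<sigma>Z[OF that]] by simp
  have \<sigma>_le: "\<bar>\<sigma> f k\<bar> \<le> c0_norm (\<sigma> f)" if "f \<in> CK_space K" for f k
    unfolding c0_norm_eq_CK_norm using le_CK_norm[OF \<sigma>_bdd[OF that]] by simp
  \<comment> \<open>Countable subadditivity is the form in which closedness of \<open>W\<close>
    enters: the partial sums paired with their images under \<open>\<sigma>\<close> form a Cauchy
    sequence in \<open>W\<close>, whose limit lies in \<open>W\<close> over \<open>f\<close> and
    hence is \<open>(\<sigma> f, f)\<close>.\<close>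
  have "\<exists>M. \<forall>f\<in>CK_space K. c0_norm (\<sigma> f) \<le> M * CK_norm K f"
  proof (rule countably_subadditive_seminorm_bounded[OF compact K_nonempty])
    show "c0_norm (\<sigma> (\<lambda>t. a * f t)) = \<bar>a\<bar> * c0_norm (\<sigma> f)" if "f \<in> CK_space K" for a f
      unfolding \<sigma>_scale[OF that] c0_norm_eq_CK_norm
      by (rule CK_norm_scale[OF UNIV_not_empty \<sigma>_bdd[OF that]])
    show "c0_norm (\<sigma> (\<lambda>t. f t + g t)) \<le> c0_norm (\<sigma> f) + c0_norm (\<sigma> g)"
      if "f \<in> CK_space K" "g \<in> CK_space K" for f g
      unfolding \<sigma>_add[OF that] c0_norm_eq_CK_norm
      by (rule CK_norm_add[OF UNIV_not_empty \<sigma>_bdd[OF that(1)] \<sigma>_bdd[OF that(2)]])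
    show "0 \<le> c0_norm (\<sigma> f)" if "f \<in> CK_space K" for f
      unfolding c0_norm_eq_CK_norm by (rule CK_norm_nonneg[OF UNIV_not_empty \<sigma>_bdd[OF that]])
    fix f and u :: "nat \<Rightarrow> 'a \<Rightarrow> real"
    assume f: "f \<in> CK_space K" and u: "\<And>k. u k \<in> CK_space K"
      and summ: "summable (\<lambda>k. c0_norm (\<sigma> (u k)))"
      and lim: "(\<lambda>m. CK_norm K (\<lambda>t. f t - (\<Sum>k<m. u k t))) \<longlonglongrightarrow> 0"
    define F where "F m = (\<lambda>t. \<Sum>k<m. u k t)" for m
    define w where "w m = (\<sigma> (F m), F m)" for m
    have FX: "F m \<in> CK_space K" and \<sigma>F: "\<sigma> (F m) = (\<lambda>k. \<Sum>i<m. \<sigma> (u i) k)" for m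
      using \<sigma>_sum[of u m, OF u] by (simp_all add: F_def)
    have wW: "w m \<in> W" for m using \<sigma> FX by (simp add: w_def)
    have wZ: "w m \<in> Z" for m using wW WZ by blast
    let ?S = "\<Sum>k. c0_norm (\<sigma> (u k))" and ?P = "\<lambda>m. \<Sum>k<m. c0_norm (\<sigma> (u k))"
    have P: "?P \<longlonglongrightarrow> ?S" using summ by (rule summable_LIMSEQ)
    have diff\<sigma>: "\<bar>\<sigma> (F m) k - \<sigma> (F n) k\<bar> \<le> \<bar>?P m - ?P n\<bar>" for m n k
    proof -
      have *: "\<bar>\<sigma> (F m) k - \<sigma> (F n) k\<bar> \<le> \<bar>?P m - ?P n\<bar>" if "n \<le> m" for m n
      proof -
        have "{..<m} = {..<n} \<union> {n..<m}" "{..<n} \<inter> {n..<m} = {}" using that by auto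
        then have split: "(\<Sum>i<m. v i) - (\<Sum>i<n. v i) = (\<Sum>i=n..<m. v i)" for v :: "nat \<Rightarrow> real"
          by (simp add: sum.union_disjoint)
        have "\<bar>\<sigma> (F m) k - \<sigma> (F n) k\<bar> = \<bar>\<Sum>i=n..<m. \<sigma> (u i) k\<bar>" by (simp add: \<sigma>F split)
        also have "\<dots> \<le> (\<Sum>i=n..<m. c0_norm (\<sigma> (u i)))"
          by (rule order_trans[OF sum_abs]) (intro sum_mono \<sigma>_le u)
        also have "\<dots> \<le> \<bar>?P m - ?P n\<bar>" by (simp add: split)
        finally show ?thesis .
      qed
      show ?thesis using *[of n m] *[of m n] by (cases "n \<le> m") (auto simp: abs_minus_commute)
    qed
    have diffF: "\<bar>f t - F m t\<bar> \<le> CK_norm K (\<lambda>t. f t - F m t)" for m t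
      by (rule abs_le_CK_norm[OF compact K_nonempty CK_space_diff[OF f FX]])
    have "\<exists>M. \<forall>m\<ge>M. \<forall>n\<ge>M. pair_norm K (pair_diff (w m) (w n)) < e" if "e > 0" for e
    proof -
      \<comment> \<open>Comparing two terms with the limit costs \<open>e / 4\<close> in each
        component, thus \<open>e / 2\<close> for the norm of the pair.\<close>
      have "e / 8 > 0" using that by simp
      from LIMSEQ_D[OF lim this] obtain M1 where M1: "\<And>m. m \<ge> M1 \<Longrightarrow> CK_norm K (\<lambda>t. f t - F m t) < e / 8"
        unfolding F_def by force
      from LIMSEQ_D[OF P \<open>e / 8 > 0\<close>] obtain M2 where M2: "\<And>m. m \<ge> M2 \<Longrightarrow> \<bar>?P m - ?S\<bar> < e / 8"
        unfolding real_norm_def by blast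
      have "pair_norm K (pair_diff (w m) (w n)) < e" if mn: "m \<ge> max M1 M2" "n \<ge> max M1 M2" for m n
      proof -
        have *: "\<bar>a - b\<bar> \<le> e / 4" if "\<bar>a - c\<bar> < e / 8" "\<bar>b - c\<bar> < e / 8" for a b c :: real
          using that by linarith
        have P4: "\<bar>?P m - ?P n\<bar> \<le> e / 4" using M2[of m] M2[of n] mn by (intro *[of _ ?S]) auto
        have "\<bar>F m t - F n t\<bar> \<le> e / 4" for t
          using diffF[of t m] diffF[of t n] M1[of m] M1[of n] mn
          by (intro *[of _ "f t"]) (auto simp: abs_minus_commute)
        then have "pair_norm K (pair_diff (w m) (w n)) \<le> e / 4 + e / 4"
          using order_trans[OF diff\<sigma> P4] by (intro pair_norm_le) (auto simp: w_def pair_add_def pair_scale_def)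
        then show ?thesis using \<open>e > 0\<close> by simp
      qed
      then show ?thesis by blast
    qed
    then have "\<forall>e>0. \<exists>M. \<forall>m\<ge>M. \<forall>n\<ge>M. pair_norm K (pair_diff (w m) (w n)) < e" by blast
    from Z_complete[OF wZ this]
    obtain l where l: "l \<in> Z" "(\<lambda>n. pair_norm K (pair_diff (w n) l)) \<longlonglongrightarrow> 0" ..
    have lW: "l \<in> W" by (rule Wclosed[OF wW l])
    have dZ: "pair_diff (w n) l \<in> Z" for n by (intro Z_add Z_scale wZ l(1))
    have conv: "(\<lambda>n. F n t) \<longlonglongrightarrow> snd l t" "(\<lambda>n. \<sigma> (F n) k) \<longlonglongrightarrow> fst l k" for t k
      using abs_le_pair_norm(1,2)[OF dZ]
      by (auto intro!: LIM_zero_cancel[OF Lim_null_comparison[OF _ l(2)]]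
          simp: w_def pair_add_def pair_scale_def)
    have "(\<lambda>n. F n t) \<longlonglongrightarrow> f t" for t
      using lim diffF unfolding F_def
      by (intro LIM_zero_cancel[OF Lim_null_comparison[OF _ lim]]) (auto simp: abs_minus_commute)
    then have "snd l = f" using conv(1) LIMSEQ_unique by blast
    then have \<sigma>f: "\<sigma> f = fst l" using lW by (intro \<sigma>_eq) (metis prod.collapse)
    have "\<bar>fst l k\<bar> \<le> ?S" for k
    proof (rule LIMSEQ_le[OF tendsto_rabs[OF conv(2)] P])
      show "\<exists>N. \<forall>n\<ge>N. \<bar>\<sigma> (F n) k\<bar> \<le> ?P n"
        unfolding \<sigma>F by (intro exI[of _ 0] allI impI order_trans[OF sum_abs] sum_mono \<sigma>_le u)
    qed
    then show "c0_norm (\<sigma> f) \<le> ?S"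
      unfolding \<sigma>f c0_norm_eq_CK_norm by (intro CK_norm_le) auto
  qed
  then obtain M where M: "\<forall>f\<in>CK_space K. c0_norm (\<sigma> f) \<le> M * CK_norm K f" ..
  \<comment> \<open>The coefficient \<open>\<alpha> p (h p)\<close> is 1, so late values of the lift
    along the branch exceed \<open>1 / 2\<close>. The threshold depends on \<open>p\<close> through
    the unknown section, hence the arbitrary function \<open>b\<close> in
    \<open>ex_common_branch\<close>.\<close>
  have "\<exists>b. \<forall>k\<ge>b. k \<in> branch p \<longrightarrow> 1 / 2 < \<sigma> (h p) k" for p
  proof -
    have "lifts (h p) (\<sigma> (h p))" using \<sigma>Z[OF h_CK] by (simp add: Z_def)
    from lifts_along_branch[OF this, of "1 / 2" p]
    obtain b where b: "\<forall>k\<ge>b. k \<in> branch p \<longrightarrow> \<bar>\<sigma> (h p) k - 1\<bar> < 1 / 2"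
      unfolding eventually_sequentially by (auto simp: \<alpha>_def h_y h_z)
    have "1 / 2 < \<sigma> (h p) k" if "k \<ge> b" "k \<in> branch p" for k
      using b[rule_format, OF that] by linarith
    then show ?thesis by blast
  qed
  then have "\<forall>p. \<exists>b. \<forall>k\<ge>b. k \<in> branch p \<longrightarrow> 1 / 2 < \<sigma> (h p) k" ..
  from choice[OF this] obtain b where b: "\<forall>p. \<forall>k\<ge>b p. k \<in> branch p \<longrightarrow> 1 / 2 < \<sigma> (h p) k" ..
  \<comment> \<open>At the common place \<open>k\<close> the value of \<open>\<sigma> F\<close> will
    be at least \<open>N / 2\<close>, while \<open>M\<close> times the norm of \<open>F\<close> is
    at most \<open>\<bar>M\<bar>\<close>.\<close>
  obtain N :: nat where N: "2 * \<bar>M\<bar> + 1 < real N" using reals_Archimedean2 by blast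
  obtain u k where uk: "\<forall>n<N. k \<in> branch (n, u n) \<and> b (n, u n) \<le> k"
    using ex_common_branch[of N b] by blast
  define F where "F t = (\<Sum>n<N. h (n, u n) t)" for t
  have FX: "F \<in> CK_space K" and \<sigma>F: "\<sigma> F k = (\<Sum>n<N. \<sigma> (h (n, u n)) k)"
    using \<sigma>_sum[of "\<lambda>n. h (n, u n)" N] h_CK unfolding F_def[abs_def] by (simp_all add: fun_eq_iff)
  \<comment> \<open>The summands belong to different levels, so at most one of them is nonzero at
    \<open>t\<close>.\<close>
  have "\<bar>F t\<bar> \<le> 1" for t
  proof (cases "\<exists>n<N. h (n, u n) t \<noteq> 0")
    case True
    then obtain n where n: "n < N" "h (n, u n) t \<noteq> 0" by blast
    have "F t = (\<Sum>m<N. if m = n then h (n, u n) t else 0)"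
      unfolding F_def using h_disjoint[of _ n "u _" t "u n"] n by (intro sum.cong) auto
    then have "F t = h (n, u n) t" using n by simp
    then show ?thesis using h_bounds[of "(n, u n)" t] by simp
  next
    case False
    then show ?thesis by (simp add: F_def)
  qed
  then have "CK_norm K F \<le> 1" by (intro CK_norm_le K_nonempty)
  have nn: "0 \<le> CK_norm K F" by (rule CK_norm_nonneg[OF K_nonempty bdd_above_CK[OF compact FX]])
  have "real N / 2 = (\<Sum>n<N. 1 / 2)" by simp
  also have "\<dots> \<le> \<sigma> F k" unfolding \<sigma>F using b uk by (intro sum_mono) (auto intro: less_imp_le)
  also have "\<dots> \<le> M * CK_norm K F" using \<sigma>_le[OF FX, of k] M FX by fastforce
  also have "\<dots> \<le> \<bar>M\<bar> * CK_norm K F" using nn by (intro mult_right_mono) auto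
  also have "\<dots> \<le> \<bar>M\<bar>" using \<open>CK_norm K F \<le> 1\<close> nn by (simp add: mult_left_le)
  finally show False using N by simp
qed

lemma nontrivial_twisted_sum: "nontrivial_twisted_sum_c0_CK K"
  unfolding nontrivial_twisted_sum_c0_CK_def
proof (intro exI conjI)
  show "banach_on Z pair_add pair_scale ((\<lambda>_. 0), (\<lambda>_. 0)) (pair_norm K)" by (rule banach_Z)
  show "inclusion ` c0_space \<subseteq> Z" unfolding inclusion_image by blast
  show "\<forall>y1\<in>c0_space. \<forall>y2\<in>c0_space. inclusion (\<lambda>n. y1 n + y2 n) = pair_add (inclusion y1) (inclusion y2)"
    by (simp add: inclusion_def pair_add_def)
  show "\<forall>a. \<forall>y\<in>c0_space. inclusion (\<lambda>n. a * y n) = pair_scale a (inclusion y)"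
    by (simp add: inclusion_def pair_scale_def)
  show "\<forall>y\<in>c0_space. pair_norm K (inclusion y) \<le> 1 * c0_norm y"
    using K_nonempty by (simp add: inclusion_def pair_norm_def CK_norm_def)
  show "snd ` Z \<subseteq> CK_space K" by (auto simp: Z_def)
  show "\<forall>v\<in>Z. \<forall>w\<in>Z. snd (pair_add v w) = (\<lambda>t. snd v t + snd w t)" by (simp add: pair_add_def)
  show "\<forall>a. \<forall>v\<in>Z. snd (pair_scale a v) = (\<lambda>t. a * snd v t)" by (simp add: pair_scale_def)
  show "\<forall>v\<in>Z. CK_norm K (snd v) \<le> 1 * pair_norm K v" using abs_le_pair_norm(4) by simp
  show "inj_on inclusion c0_space" by (auto simp: inclusion_def inj_on_def)
  show "inclusion ` c0_space = {v \<in> Z. snd v = (\<lambda>_. 0)}" by (rule inclusion_image)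
  show "snd ` Z = CK_space K"
  proof
    show "CK_space K \<subseteq> snd ` Z"
    proof
      fix f assume f: "f \<in> CK_space K"
      then obtain s where "lifts f s" using ex_lifts by blast
      then have "(s, f) \<in> Z" using f by (simp add: Z_def)
      then show "f \<in> snd ` Z" by force
    qed
  qed (auto simp: Z_def)
  show "\<not> complemented_on Z pair_add pair_scale ((\<lambda>_. 0), (\<lambda>_. 0)) (pair_norm K) (inclusion ` c0_space)"
    by (rule not_complemented)
qed

end

text \<open>By comparability of cardinals, a set that does not dominate the reals embeds into them,
  and CH makes its uncountable image as large as the reals.\<close>

lemma CH_card_ge_continuum:
  assumes "CH" "\<not> countable B" shows "card_ge_continuum B"
proof (cases "(UNIV :: real set) \<lesssim> B")
  case True
  then show ?thesis by (simp add: card_ge_continuum_iff)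
next
  case False
  then have "B \<lesssim> (UNIV :: real set)"
    using ordLeq_total[OF card_of_Well_order card_of_Well_order, of B "UNIV :: real set"]
    unfolding lepoll_def card_of_ordLeq by blast
  then obtain f :: "'a \<Rightarrow> real" where f: "inj_on f B" by (auto simp: lepoll_def)
  then have "\<not> countable (f ` B)" using assms(2) by (simp add: countable_image_inj_eq)
  then obtain e where "bij_betw e (f ` B) (UNIV :: real set)" using assms(1) unfolding CH_def by blast
  then have "f ` B \<approx> (UNIV :: real set)" unfolding eqpoll_def by blast
  then have "(UNIV :: real set) \<lesssim> f ` B" by (simp add: eqpoll_imp_lepoll eqpoll_sym)
  then show ?thesis
    unfolding card_ge_continuum_iff using image_lepoll lepoll_trans by blast
qed

theorem theorem3p3:
  fixes K :: "'a::t2_space set" and x :: 'a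
    and I :: "'i set" and \<phi> :: "'a \<Rightarrow> 'i \<Rightarrow> real"
  assumes "compact K"
    and "Valdivia_via K I \<phi>"
    and "G_delta_point K x"
  shows "(local_weight_ge_continuum K x \<longrightarrow> nontrivial_twisted_sum_c0_CK K) \<and>
         (CH \<and> (\<forall>V. \<not> second_countable_nbhd K x V) \<longrightarrow> nontrivial_twisted_sum_c0_CK K)"
proof -
  obtain A where A: "Sigma_subset K I \<phi> A" "K \<subseteq> closure A"
    using assms(2) unfolding Valdivia_via_def by blast
  interpret valdivia K I \<phi> A
    using assms(1) A by unfold_locales (auto simp: Sigma_subset_def)
  have main: "nontrivial_twisted_sum_c0_CK K" if large: "local_weight_ge_continuum K x"
  proof -
    obtain y z h where "null_system K y z h" using ex_null_system[OF assms(3) large] by blast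
    then show ?thesis by (rule null_system.nontrivial_twisted_sum)
  qed
  \<comment> \<open>Every base of every neighbourhood of \<open>x\<close> is uncountable here, so CH
    gives it at least continuum many members.\<close>
  have "local_weight_ge_continuum K x" if "CH" "\<forall>V. \<not> second_countable_nbhd K x V"
    unfolding local_weight_ge_continuum_def
  proof (intro allI impI)
    fix V B assume "nbhd_in K x V \<and> is_base_on V B"
    then have "\<not> countable B" using that(2) unfolding second_countable_nbhd_def by blast
    then show "card_ge_continuum B" by (rule CH_card_ge_continuum[OF that(1)])
  qed
  with main show ?thesis by blast
qed

end
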